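(* SDMT-1 (defined in the context) terminates in time $O(n_1^2\gamma+m)$, where $n_1$ is the number of agents, $\gamma$ is the size of the largest indifference class in any agent's preference list of the given House Allocation instance, and $m$ is the total length of the agents' preference lists (the number of acceptable (agent, object) pairs).
   Context: House Allocation (HA). $N$ is a finite set of $n_1$ agents, $O$ a finite set of objects. Each agent $i$ has a preference list $L(i)=(C^i_1\succ_i C^i_2\succ_i\cdots)$, an ordered sequence of pairwise disjoint subsets of $O$ (indifference classes, all nonempty classes coming first); objects in $C^i_k$ are strictly preferred to those in $C^i_l$ for $k<l$, and $i$ is indifferent between objects in the same class. Objects in $\bigcup_k C^i_k$ are acceptable to $i$. SDMT-1, given an order $\sigma$ of the agents: start with the bipartite graph $G=(N\cup O,E)$, $E=\emptyset$, and $\mu=\emptyset$. Process agents in the order $\sigma$. For the current agent $i$, for $\ell=1,2,\dots$ while $C^i_\ell\neq\emptyset$: add the edges $\{(i,o):o\in C^i_\ell\}$ to $E$; if $G$ contains an augmenting path with respect to $\mu$ starting at $i$ (a path from $i$ to an unmatched object, alternating between edges not in $\mu$ and edges in $\mu$), choose any such path, replace $\mu$ by its symmetric difference with the path, and go to the next agent; otherwise remove the edges just added and increase $\ell$ by one. Return $\mu$ after all agents are processed. Searches for augmenting paths are implemented by breadth-first search; running time is worst-case time in the standard random access machine model. *)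

theory Defs
  imports Main
begin

section \<open>House allocation instances\<close>

text \<open>
  Agents and objects are named by indices: the set of agents is \<open>{..<num_agents I}\<close>, the set of
  objects is \<open>{..<num_objects I}\<close>, and \<open>pref I i\<close> lists the nonempty indifference classes
  of agent \<open>i\<close>, best class first.
\<close>

record instance_ha =
  num_agents :: nat
  num_objects :: nat
  pref :: "nat \<Rightarrow> nat set list"

definition ha_instance :: "instance_ha \<Rightarrow> bool" where
  "ha_instance I \<longleftrightarrow>
     (\<forall>i<num_agents I.
        (\<forall>C\<in>set (pref I i). C \<noteq> {} \<and> C \<subseteq> {..<num_objects I}) \<and>
        (\<forall>k<length (pref I i). \<forall>l<length (pref I i).
            k \<noteq> l \<longrightarrow> pref I i ! k \<inter> pref I i ! l = {}))"

text \<open>Levels are counted from 0; beyond the end of the list all classes are empty.\<close>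

definition indiff_class :: "instance_ha \<Rightarrow> nat \<Rightarrow> nat \<Rightarrow> nat set" where
  "indiff_class I i l = (if l < length (pref I i) then pref I i ! l else {})"

definition max_class_size :: "instance_ha \<Rightarrow> nat" where
  "max_class_size I = Max (insert 0 {card C | C i. i < num_agents I \<and> C \<in> set (pref I i)})"

definition total_pref_length :: "instance_ha \<Rightarrow> nat" where
  "total_pref_length I = card {(i, ob). i < num_agents I \<and> ob \<in> \<Union> (set (pref I i))}"

definition agent_order :: "instance_ha \<Rightarrow> nat list \<Rightarrow> bool" where
  "agent_order I \<sigma> \<longleftrightarrow> distinct \<sigma> \<and> set \<sigma> = {..<num_agents I}"


section \<open>The mechanism SDMT-1\<close>

datatype vertex = Agent nat | Obj nat

type_synonym edges = "vertex set set"

definition path_edges :: "vertex list \<Rightarrow> edges" where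
  "path_edges p = {{p ! k, p ! Suc k} | k. Suc k < length p}"

definition augmenting_path :: "instance_ha \<Rightarrow> edges \<Rightarrow> edges \<Rightarrow> nat \<Rightarrow> vertex list \<Rightarrow> bool" where
  "augmenting_path I E M i p \<longleftrightarrow>
     p \<noteq> [] \<and> distinct p \<and> hd p = Agent i \<and>
     (\<exists>ob<num_objects I. last p = Obj ob \<and> (\<forall>e\<in>M. Obj ob \<notin> e)) \<and>
     (\<forall>k. Suc k < length p \<longrightarrow>
        {p ! k, p ! Suc k} \<in> E \<and> ({p ! k, p ! Suc k} \<in> M \<longleftrightarrow> odd k))"

definition class_edges :: "instance_ha \<Rightarrow> nat \<Rightarrow> nat \<Rightarrow> edges" where
  "class_edges I i l = {{Agent i, Obj ob} | ob. ob \<in> indiff_class I i l}"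

text \<open>
  A state \<open>(E, M, is, l)\<close> consists of the current edge set and matching, the agents still to be
  processed (the current one first) and the level of the current agent that is tried next.
  SDMT-1 may augment along any augmenting path; the parameter \<open>sel E M i p\<close> restricts the
  paths that may be picked among the augmenting ones (always true for SDMT-1 as such).
\<close>

type_synonym sdmt_state = "edges \<times> edges \<times> nat list \<times> nat"

inductive sdmt1_step ::
  "instance_ha \<Rightarrow> (edges \<Rightarrow> edges \<Rightarrow> nat \<Rightarrow> vertex list \<Rightarrow> bool) \<Rightarrow> sdmt_state \<Rightarrow> sdmt_state \<Rightarrow> bool"
  for I sel where
  augment:
    "\<lbrakk> indiff_class I i l \<noteq> {}; E' = E \<union> class_edges I i l;
       augmenting_path I E' M i p; sel E' M i p \<rbrakk>
     \<Longrightarrow> sdmt1_step I sel (E, M, i # is, l) (E', sym_diff M (path_edges p), is, 0)"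
| reject:
    "\<lbrakk> indiff_class I i l \<noteq> {}; E' = E \<union> class_edges I i l;
       \<nexists>p. augmenting_path I E' M i p \<rbrakk>
     \<Longrightarrow> sdmt1_step I sel (E, M, i # is, l) (E' - class_edges I i l, M, i # is, Suc l)"
| exhausted:
    "indiff_class I i l = {} \<Longrightarrow> sdmt1_step I sel (E, M, i # is, l) (E, M, is, 0)"

text \<open>A complete execution, as the list of all states passed through.\<close>

definition sdmt1_run ::
  "instance_ha \<Rightarrow> (edges \<Rightarrow> edges \<Rightarrow> nat \<Rightarrow> vertex list \<Rightarrow> bool) \<Rightarrow> nat list \<Rightarrow> sdmt_state list \<Rightarrow> bool" where
  "sdmt1_run I sel \<sigma> ss \<longleftrightarrow>
     ss \<noteq> [] \<and> hd ss = ({}, {}, \<sigma>, 0) \<and>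
     (\<forall>k. Suc k < length ss \<longrightarrow> sdmt1_step I sel (ss ! k) (ss ! Suc k)) \<and>
     (\<exists>E M l. last ss = (E, M, [], l))"

text \<open>Breadth-first search from \<open>Agent i\<close> returns an augmenting path with fewest edges.\<close>

definition bfs_selection :: "instance_ha \<Rightarrow> edges \<Rightarrow> edges \<Rightarrow> nat \<Rightarrow> vertex list \<Rightarrow> bool" where
  "bfs_selection I E M i p \<longleftrightarrow>
     (\<forall>q. augmenting_path I E M i q \<longrightarrow> length p \<le> length q)"


section \<open>Random access machine\<close>

text \<open>
  A uniform-cost random access machine: every instruction takes one unit of time. Registers are
  named by the program text; the memory is reached through an address held in a register.
  Subtraction is truncated at 0.
\<close>

datatype instr =
    Const nat nat         \<comment> \<open>\<open>Const r n\<close>: r := n\<close>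
  | Add nat nat nat       \<comment> \<open>\<open>Add r a b\<close>: r := a + b\<close>
  | Sub nat nat nat       \<comment> \<open>\<open>Sub r a b\<close>: r := a - b\<close>
  | Load nat nat          \<comment> \<open>\<open>Load r a\<close>: r := memory[a]\<close>
  | Store nat nat         \<comment> \<open>\<open>Store a r\<close>: memory[a] := r\<close>
  | Jump nat              \<comment> \<open>\<open>Jump q\<close>: go to instruction q\<close>
  | JumpLess nat nat nat  \<comment> \<open>\<open>JumpLess a b q\<close>: if a < b go to instruction q\<close>

record config =
  pc :: nat
  reg :: "nat \<Rightarrow> nat"
  mem :: "nat \<Rightarrow> nat"

definition set_reg :: "nat \<Rightarrow> nat \<Rightarrow> config \<Rightarrow> config" where
  "set_reg r v c = c\<lparr>pc := Suc (pc c), reg := (reg c)(r := v)\<rparr>"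

fun exec_instr :: "instr \<Rightarrow> config \<Rightarrow> config" where
  "exec_instr (Const r n) c = set_reg r n c"
| "exec_instr (Add r a b) c = set_reg r (reg c a + reg c b) c"
| "exec_instr (Sub r a b) c = set_reg r (reg c a - reg c b) c"
| "exec_instr (Load r a) c = set_reg r (mem c (reg c a)) c"
| "exec_instr (Store a r) c = c\<lparr>pc := Suc (pc c), mem := (mem c)(reg c a := reg c r)\<rparr>"
| "exec_instr (Jump q) c = c\<lparr>pc := q\<rparr>"
| "exec_instr (JumpLess a b q) c = c\<lparr>pc := (if reg c a < reg c b then q else Suc (pc c))\<rparr>"

text \<open>The machine halts by leaving the program text.\<close>

definition halted :: "instr list \<Rightarrow> config \<Rightarrow> bool" where
  "halted P c \<longleftrightarrow> length P \<le> pc c"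

definition ram_step :: "instr list \<Rightarrow> config \<Rightarrow> config" where
  "ram_step P c = (if halted P c then c else exec_instr (P ! pc c) c)"

definition initial_config :: "nat list \<Rightarrow> config" where
  "initial_config w =
     \<lparr>pc = 0, reg = (\<lambda>_. 0), mem = (\<lambda>a. if a < length w then w ! a else 0)\<rparr>"

definition ram_config :: "instr list \<Rightarrow> nat list \<Rightarrow> nat \<Rightarrow> config" where
  "ram_config P w t = (ram_step P ^^ t) (initial_config w)"

definition halts_at :: "instr list \<Rightarrow> nat list \<Rightarrow> nat \<Rightarrow> bool" where
  "halts_at P w T \<longleftrightarrow>
     halted P (ram_config P w T) \<and> (\<forall>t<T. \<not> halted P (ram_config P w t))"


section \<open>Implementing SDMT-1 on the machine\<close>

text \<open>
  Input: the numbers of agents and of objects, the order of the agents, and for agents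
  0, 1, ... the number of classes followed by the classes, each as its size and its members
  in some order.
\<close>

definition class_word :: "nat list \<Rightarrow> nat list" where
  "class_word xs = length xs # xs"

definition agent_word :: "nat list list \<Rightarrow> nat list" where
  "agent_word cs = length cs # concat (map class_word cs)"

definition input_word :: "instance_ha \<Rightarrow> nat list \<Rightarrow> nat list \<Rightarrow> bool" where
  "input_word I \<sigma> w \<longleftrightarrow>
     (\<exists>ls. length ls = num_agents I \<and>
        (\<forall>i<num_agents I. map set (ls ! i) = pref I i \<and> (\<forall>xs\<in>set (ls ! i). distinct xs)) \<and>
        w = [num_agents I, num_objects I] @ \<sigma> @ concat (map agent_word ls))"

text \<open>
  Register 0 points to an array indexed by the agents, with entry 0 for an unmatched agent
  and \<open>ob + 1\<close> for an agent matched to \<open>ob\<close>.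
\<close>

definition holds_matching :: "instance_ha \<Rightarrow> config \<Rightarrow> edges \<Rightarrow> bool" where
  "holds_matching I c M \<longleftrightarrow>
     (\<forall>i<num_agents I. \<forall>ob. {Agent i, Obj ob} \<in> M \<longleftrightarrow> mem c (reg c 0 + i) = Suc ob)"

text \<open>
  On input \<open>w\<close>, the program carries out an execution of SDMT-1 step by step and halts after
  exactly \<open>T\<close> machine steps: at strictly increasing times \<open>ts\<close>, the last one being \<open>T\<close>, it
  holds the matchings of the successive states of the execution.
\<close>

definition performs_sdmt1 ::
  "instr list \<Rightarrow> instance_ha \<Rightarrow> nat list \<Rightarrow> nat list \<Rightarrow> nat \<Rightarrow> bool" where
  "performs_sdmt1 P I \<sigma> w T \<longleftrightarrow>
     halts_at P w T \<and>
     (\<exists>ss ts. sdmt1_run I (bfs_selection I) \<sigma> ss \<and>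
        length ts = length ss \<and> sorted_wrt (<) ts \<and> last ts = T \<and>
        (\<forall>k<length ss. holds_matching I (ram_config P w (ts ! k)) (fst (snd (ss ! k)))))"

end

theory Submission
  imports Defs
begin

text \<open>
  All searches for one agent \<open>i\<close> share their visited marks: an agent reached in a failed search
  for some class of \<open>i\<close> cannot reach a free object, and this stays so when the next class is tried,
  because only edges at \<open>i\<close> change. Hence every agent is explored at most once per \<open>i\<close>, at a cost
  proportional to \<open>\<gamma>\<close>, the size bound of the single class that the graph contains for it; this is
  \<open>O(n\<^sub>1 \<gamma>)\<close> for each \<open>i\<close>, and scanning the classes of \<open>i\<close> itself adds up to \<open>O(m)\<close>. Not
  exploring these agents again does not spoil the choice of a shortest path, since no augmenting
  path can pass through them. Time stamps make it unnecessary to clear the marks, and memory is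
  initially zero, so nothing of the order of the number of objects has to be initialized.
\<close>

section \<open>Structured programs for the random access machine\<close>

text \<open>The time stamp of a turn is the address of its agent in the input order. These addresses
  start at 2 and increase, so zeroed memory contains no valid stamp. Augmenting never leaves an
  agent unmatched and a rejected class loses its edges, so only matched agents and \<open>i\<close>
  ever have edges, each to a single class; one class address per agent describes the whole graph.
  The delicate point is minimality of the path when old marks are kept. The lower bound on the
  length of augmenting paths needs only layers of agents that contain \<open>i\<close> and are
  closed under alternating steps. The old agents can therefore be put into layer 0, even though no
  search reaches them from the current class. Time is a resource of the program logic. The saving
  over the classes of one agent then becomes a potential in the invariants, which a failed search
  hands on to the next class. The time bound is stated for positive \<open>\<gamma>\<close>: if all
  lists are empty, the bounding expression is 0, but the machine still takes steps.\<close>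

definition occurs_at :: "'a list \<Rightarrow> nat \<Rightarrow> 'a list \<Rightarrow> bool" where
  "occurs_at xs n ys \<longleftrightarrow> (\<forall>k<length ys. n + k < length xs \<and> xs ! (n + k) = ys ! k)"

lemma occurs_at_Nil [simp]: "occurs_at xs n []"
  by (simp add: occurs_at_def)

lemma occurs_at_Cons [simp]:
  "occurs_at xs n (y # ys) \<longleftrightarrow> n < length xs \<and> xs ! n = y \<and> occurs_at xs (Suc n) ys"
  unfolding occurs_at_def by (auto simp: All_less_Suc2)

lemma occurs_at_append [simp]:
  "occurs_at xs n (ys @ zs) \<longleftrightarrow> occurs_at xs n ys \<and> occurs_at xs (n + length ys) zs"
  by (induction ys arbitrary: n) simp_all

lemma occurs_at_self: "occurs_at xs 0 xs"
  by (simp add: occurs_at_def)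

datatype com =
    Block "instr list"
  | Seq com com  (infixr ";;" 60)
  | If_less nat nat com com
  | While_less nat nat com

fun code_size :: "com \<Rightarrow> nat" where
  "code_size (Block is) = length is"
| "code_size (c ;; d) = code_size c + code_size d"
| "code_size (If_less a b c d) = code_size c + code_size d + 2"
| "code_size (While_less a b c) = code_size c + 3"

text \<open>Jump targets are absolute, so the code depends on the address \<open>n\<close> at which
  it is placed. The else-branch comes first: a failing test simply falls through.\<close>

fun compile :: "nat \<Rightarrow> com \<Rightarrow> instr list" where
  "compile n (Block is) = is"
| "compile n (c ;; d) = compile n c @ compile (n + code_size c) d"
| "compile n (If_less a b c d) =
     JumpLess a b (n + code_size d + 2) # compile (Suc n) d @
     Jump (n + code_size c + code_size d + 2) # compile (n + code_size d + 2) c"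
| "compile n (While_less a b c) =
     [JumpLess a b (n + 2), Jump (n + code_size c + 3)] @ compile (n + 2) c @ [Jump n]"

lemma length_compile [simp]: "length (compile n c) = code_size c"
  by (induction c arbitrary: n) simp_all

section \<open>Execution of straight-line code\<close>

definition config_at :: "nat \<Rightarrow> (nat \<Rightarrow> nat) \<Rightarrow> (nat \<Rightarrow> nat) \<Rightarrow> config" where
  "config_at n r m = \<lparr>pc = n, reg = r, mem = m\<rparr>"

lemma config_at_simps [simp]:
  "pc (config_at n r m) = n" "reg (config_at n r m) = r" "mem (config_at n r m) = m"
  by (simp_all add: config_at_def)

text \<open>\<open>ram_step\<close> stands still once the machine has halted, so the second conjunct
  is what makes \<open>t\<close> an exact number of executed instructions, as
  \<open>halts_at\<close> demands.\<close>

definition reaches :: "instr list \<Rightarrow> config \<Rightarrow> nat \<Rightarrow> config \<Rightarrow> bool" where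
  "reaches P c t c' \<longleftrightarrow>
     (ram_step P ^^ t) c = c' \<and> (\<forall>s<t. \<not> halted P ((ram_step P ^^ s) c))"

lemma reaches_0 [simp]: "reaches P c 0 c' \<longleftrightarrow> c' = c"
  by (auto simp: reaches_def)

lemma reaches_trans:
  assumes "reaches P c s c'" "reaches P c' t c''"
  shows "reaches P c (s + t) c''"
proof -
  have eq: "(ram_step P ^^ (u + s)) c = (ram_step P ^^ u) c'" for u
    using assms(1) by (simp add: reaches_def funpow_add)
  have "\<not> halted P ((ram_step P ^^ u) c)" if "u < s + t" for u
  proof (cases "u < s")
    case True
    then show ?thesis using assms(1) by (simp add: reaches_def)
  next
    case False
    then have "u = (u - s) + s" "u - s < t" using that by auto
    then show ?thesis using assms(2) eq[of "u - s"] by (auto simp: reaches_def)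
  qed
  then show ?thesis
    using assms(2) eq[of t] by (simp add: reaches_def add.commute)
qed

lemma reaches_step:
  assumes "n < length P"
  shows "reaches P (config_at n r m) 1 (exec_instr (P ! n) (config_at n r m))"
  using assms by (simp add: reaches_def ram_step_def halted_def)

fun effect :: "instr \<Rightarrow> (nat \<Rightarrow> nat) \<times> (nat \<Rightarrow> nat) \<Rightarrow> (nat \<Rightarrow> nat) \<times> (nat \<Rightarrow> nat)" where
  "effect (Const x v) (r, m) = (r(x := v), m)"
| "effect (Add x a b) (r, m) = (r(x := r a + r b), m)"
| "effect (Sub x a b) (r, m) = (r(x := r a - r b), m)"
| "effect (Load x a) (r, m) = (r(x := m (r a)), m)"
| "effect (Store a x) (r, m) = (r, m(r a := r x))"
| "effect (Jump q) s = s"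
| "effect (JumpLess a b q) s = s"

fun effects :: "instr list \<Rightarrow> (nat \<Rightarrow> nat) \<times> (nat \<Rightarrow> nat) \<Rightarrow> (nat \<Rightarrow> nat) \<times> (nat \<Rightarrow> nat)" where
  "effects [] s = s"
| "effects (i # is) s = effects is (effect i s)"

fun is_jump :: "instr \<Rightarrow> bool" where
  "is_jump (Jump q) = True"
| "is_jump (JumpLess a b q) = True"
| "is_jump _ = False"

lemma exec_instr_effect:
  "\<not> is_jump i \<Longrightarrow>
   exec_instr i (config_at n r m) = config_at (Suc n) (fst (effect i (r, m))) (snd (effect i (r, m)))"
  by (cases i) (simp_all add: config_at_def set_reg_def)

lemma reaches_block:
  assumes "occurs_at P n is" "\<forall>i\<in>set is. \<not> is_jump i"
  shows "reaches P (config_at n r m) (length is)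
           (config_at (n + length is) (fst (effects is (r, m))) (snd (effects is (r, m))))"
  using assms
proof (induction "is" arbitrary: n r m)
  case (Cons i "is")
  let ?r = "fst (effect i (r, m))" and ?m = "snd (effect i (r, m))"
  have "reaches P (config_at n r m) 1 (config_at (Suc n) ?r ?m)"
    using reaches_step[of n P r m] Cons.prems by (simp add: exec_instr_effect)
  moreover have "reaches P (config_at (Suc n) ?r ?m) (length is)
      (config_at (Suc n + length is) (fst (effects is (?r, ?m))) (snd (effects is (?r, ?m))))"
    using Cons.IH[of "Suc n" ?r ?m] Cons.prems by simp
  ultimately show ?case using reaches_trans by fastforce
qed simp

section \<open>A program logic with time credits\<close>

text \<open>
  The last argument counts time credits: the code runs from the given registers and memory into
  a configuration satisfying \<open>Q\<close>, paying one credit per machine step; credits may be wasted.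
\<close>

definition wp ::
  "com \<Rightarrow> ((nat \<Rightarrow> nat) \<Rightarrow> (nat \<Rightarrow> nat) \<Rightarrow> nat \<Rightarrow> bool) \<Rightarrow>
   (nat \<Rightarrow> nat) \<Rightarrow> (nat \<Rightarrow> nat) \<Rightarrow> nat \<Rightarrow> bool" where
  "wp c Q r m k \<longleftrightarrow>
     (\<forall>P n. occurs_at P n (compile n c) \<longrightarrow>
        (\<exists>t k' r' m'. t + k' \<le> k \<and> Q r' m' k' \<and>
           reaches P (config_at n r m) t (config_at (n + code_size c) r' m')))"

lemma wpI:
  assumes "\<And>P n. occurs_at P n (compile n c) \<Longrightarrow>
      \<exists>t k' r' m'. t + k' \<le> k \<and> Q r' m' k' \<and>
        reaches P (config_at n r m) t (config_at (n + code_size c) r' m')"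
  shows "wp c Q r m k"
  using assms by (auto simp: wp_def)

lemma wpE:
  assumes "wp c Q r m k" "occurs_at P n (compile n c)"
  obtains t k' r' m' where "t + k' \<le> k" "Q r' m' k'"
    "reaches P (config_at n r m) t (config_at (n + code_size c) r' m')"
  using assms unfolding wp_def by blast

lemma wp_mono:
  assumes "wp c Q r m k" "\<And>r m k. Q r m k \<Longrightarrow> Q' r m k" "k \<le> k'"
  shows "wp c Q' r m k'"
proof (rule wpI)
  fix P n
  assume "occurs_at P n (compile n c)"
  with assms(1) obtain t l r' m' where "t + l \<le> k" "Q r' m' l"
    "reaches P (config_at n r m) t (config_at (n + code_size c) r' m')"
    by (rule wpE)
  then show "\<exists>t k'' r' m'. t + k'' \<le> k' \<and> Q' r' m' k'' \<and>
      reaches P (config_at n r m) t (config_at (n + code_size c) r' m')"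
    using assms(2,3) le_trans by blast
qed

lemma wp_Block:
  assumes "effects is (r, m) = (r', m')" "\<forall>i\<in>set is. \<not> is_jump i" "length is \<le> k"
    and "Q r' m' (k - length is)"
  shows "wp (Block is) Q r m k"
proof (rule wpI)
  fix P n
  assume "occurs_at P n (compile n (Block is))"
  then have "reaches P (config_at n r m) (length is) (config_at (n + length is) r' m')"
    using reaches_block[of P n "is" r m] assms(1,2) by simp
  then show "\<exists>t k' r' m'. t + k' \<le> k \<and> Q r' m' k' \<and>
      reaches P (config_at n r m) t (config_at (n + code_size (Block is)) r' m')"
    using assms(3,4)
    by (intro exI[of _ "length is"] exI[of _ "k - length is"] exI[of _ r'] exI[of _ m']) simp
qed

lemma wp_Seq:
  assumes "wp c (wp d Q) r m k"
  shows "wp (c ;; d) Q r m k"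
proof (rule wpI)
  fix P n
  assume "occurs_at P n (compile n (c ;; d))"
  then have oc: "occurs_at P n (compile n c)"
    and od: "occurs_at P (n + code_size c) (compile (n + code_size c) d)"
    by simp_all
  from assms oc obtain t l r' m' where 1: "t + l \<le> k" "wp d Q r' m' l"
    "reaches P (config_at n r m) t (config_at (n + code_size c) r' m')"
    by (rule wpE)
  from 1(2) od obtain t' l' r'' m'' where 2: "t' + l' \<le> l" "Q r'' m'' l'"
    "reaches P (config_at (n + code_size c) r' m') t'
       (config_at (n + code_size c + code_size d) r'' m'')"
    by (rule wpE)
  have "reaches P (config_at n r m) (t + t') (config_at (n + code_size (c ;; d)) r'' m'')"
    using reaches_trans[OF 1(3) 2(3)] by (simp add: add.assoc)
  moreover have "t + t' + l' \<le> k" using 1(1) 2(1) by simp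
  ultimately show "\<exists>t k' r' m'. t + k' \<le> k \<and> Q r' m' k' \<and>
      reaches P (config_at n r m) t (config_at (n + code_size (c ;; d)) r' m')"
    using 2(2) by blast
qed

lemma wp_Block_Seq:
  assumes "effects is (r, m) = (r', m')" "\<forall>i\<in>set is. \<not> is_jump i" "length is \<le> k"
    and "wp d Q r' m' (k - length is)"
  shows "wp (Block is ;; d) Q r m k"
  by (rule wp_Seq, rule wp_Block) (fact assms)+

lemma reaches_JumpLess:
  assumes "n < length P" "P ! n = JumpLess a b q"
  shows "reaches P (config_at n r m) 1 (config_at (if r a < r b then q else Suc n) r m)"
  using reaches_step[OF assms(1), of r m] assms(2) by (auto simp: config_at_def)

lemma reaches_Jump:
  assumes "n < length P" "P ! n = Jump q"
  shows "reaches P (config_at n r m) 1 (config_at q r m)"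
  using reaches_step[OF assms(1), of r m] assms(2) by (simp add: config_at_def)

text \<open>Two credits cover both branches: the else-branch spends them on the test and on the jump
  over the other branch, the then-branch wastes one.\<close>

lemma wp_If_less:
  assumes "2 \<le> k"
    and "r a < r b \<Longrightarrow> wp c Q r m (k - 2)"
    and "\<not> r a < r b \<Longrightarrow> wp d Q r m (k - 2)"
  shows "wp (If_less a b c d) Q r m k"
proof (rule wpI)
  fix P n
  assume oc: "occurs_at P n (compile n (If_less a b c d))"
  let ?end = "n + code_size (If_less a b c d)"
  have test: "reaches P (config_at n r m) 1
      (config_at (if r a < r b then n + code_size d + 2 else Suc n) r m)"
    using oc by (intro reaches_JumpLess) auto
  show "\<exists>t k' r' m'. t + k' \<le> k \<and> Q r' m' k' \<and> reaches P (config_at n r m) t (config_at ?end r' m')"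
  proof (cases "r a < r b")
    case True
    have "occurs_at P (n + code_size d + 2) (compile (n + code_size d + 2) c)"
      using oc by simp
    with assms(2)[OF True] obtain t l r' m' where 1: "t + l \<le> k - 2" "Q r' m' l"
      "reaches P (config_at (n + code_size d + 2) r m) t
         (config_at (n + code_size d + 2 + code_size c) r' m')"
      by (rule wpE)
    have "reaches P (config_at n r m) (1 + t) (config_at ?end r' m')"
      using reaches_trans[OF test, of t] 1(3) True by (simp add: algebra_simps)
    moreover have "1 + t + l \<le> k" using 1(1) assms(1) by simp
    ultimately show ?thesis using 1(2) by blast
  next
    case False
    have "occurs_at P (Suc n) (compile (Suc n) d)"
      using oc by simp
    with assms(3)[OF False] obtain t l r' m' where 1: "t + l \<le> k - 2" "Q r' m' l"
      "reaches P (config_at (Suc n) r m) t (config_at (Suc n + code_size d) r' m')"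
      by (rule wpE)
    have jump: "reaches P (config_at (Suc n + code_size d) r' m') 1 (config_at ?end r' m')"
      using oc by (intro reaches_Jump) (auto simp: algebra_simps)
    have "reaches P (config_at n r m) (1 + t) (config_at (Suc n + code_size d) r' m')"
      using reaches_trans[OF test, of t] 1(3) False by simp
    then have "reaches P (config_at n r m) (1 + t + 1) (config_at ?end r' m')"
      using jump by (rule reaches_trans)
    moreover have "1 + t + 1 + l \<le> k" using 1(1) assms(1) by simp
    ultimately show ?thesis using 1(2) by blast
  qed
qed

text \<open>\<open>0 < t\<close> serves twice: it makes induction on credits possible, and it makes
  the times of successive states of SDMT-1 strictly increasing.\<close>

lemma reaches_While_iteration:
  assumes "occurs_at P n (compile n (While_less a b c))" "r a < r b" "2 \<le> k" "wp c Q r m (k - 2)"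
  obtains t k' r' m' where "0 < t" "t + k' \<le> k" "Q r' m' k'"
    "reaches P (config_at n r m) t (config_at n r' m')"
proof -
  have test: "reaches P (config_at n r m) 1 (config_at (n + 2) r m)"
    using reaches_JumpLess[of n P a b "n + 2" r m] assms(1,2) by simp
  have "occurs_at P (n + 2) (compile (n + 2) c)"
    using assms(1) by simp
  with assms(4) obtain t l r' m' where 1: "t + l \<le> k - 2" "Q r' m' l"
    "reaches P (config_at (n + 2) r m) t (config_at (n + 2 + code_size c) r' m')"
    by (rule wpE)
  have jump: "reaches P (config_at (n + 2 + code_size c) r' m') 1 (config_at n r' m')"
    using assms(1) by (intro reaches_Jump) simp_all
  have "reaches P (config_at n r m) (1 + t + 1) (config_at n r' m')"
    using reaches_trans[OF reaches_trans[OF test 1(3)] jump] .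
  moreover have "1 + t + 1 + l \<le> k" using 1(1) assms(3) by simp
  ultimately show thesis using 1(2) that[of "1 + t + 1"] by simp
qed

lemma reaches_While_exit:
  assumes "occurs_at P n (compile n (While_less a b c))" "\<not> r a < r b"
  shows "reaches P (config_at n r m) 2 (config_at (n + code_size (While_less a b c)) r m)"
proof -
  have "reaches P (config_at n r m) 1 (config_at (Suc n) r m)"
    using reaches_JumpLess[of n P a b "n + 2" r m] assms by simp
  moreover have "reaches P (config_at (Suc n) r m) 1
      (config_at (n + code_size (While_less a b c)) r m)"
    using assms(1) by (intro reaches_Jump) (simp_all add: algebra_simps)
  ultimately have "reaches P (config_at n r m) (1 + 1)
      (config_at (n + code_size (While_less a b c)) r m)"
    by (rule reaches_trans)
  then show ?thesis by (simp add: numeral_2_eq_2)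
qed

text \<open>No separate variant is needed: every iteration uses up credits.\<close>

lemma wp_While_less:
  assumes "Inv r m k"
    and step: "\<And>r m k. Inv r m k \<Longrightarrow> r a < r b \<Longrightarrow> 2 \<le> k \<and> wp c Inv r m (k - 2)"
    and exit: "\<And>r m k. Inv r m k \<Longrightarrow> \<not> r a < r b \<Longrightarrow> 2 \<le> k \<and> Q r m (k - 2)"
  shows "wp (While_less a b c) Q r m k"
proof (rule wpI)
  fix P n
  assume oc: "occurs_at P n (compile n (While_less a b c))"
  let ?end = "n + code_size (While_less a b c)"
  show "\<exists>t k' r' m'. t + k' \<le> k \<and> Q r' m' k' \<and> reaches P (config_at n r m) t (config_at ?end r' m')"
    using assms(1)
  proof (induction k arbitrary: r m rule: less_induct)
    case (less k)
    show ?case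
    proof (cases "r a < r b")
      case True
      with step less.prems have k: "2 \<le> k" and wp: "wp c Inv r m (k - 2)" by blast+
      obtain t l r' m' where 1: "0 < t" "t + l \<le> k" "Inv r' m' l"
        "reaches P (config_at n r m) t (config_at n r' m')"
        using reaches_While_iteration[OF oc True k wp] .
      then obtain t' l' r'' m'' where 2: "t' + l' \<le> l" "Q r'' m'' l'"
        "reaches P (config_at n r' m') t' (config_at ?end r'' m'')"
        using less.IH[of l r' m'] by auto
      have "t + t' + l' \<le> k" using 1 2 by simp
      then show ?thesis using 2(2) reaches_trans[OF 1(4) 2(3)] by blast
    next
      case False
      have "2 \<le> k" "Q r m (k - 2)" using exit[OF less.prems False] by simp_all
      moreover from this have "2 + (k - 2) \<le> k" by simp
      ultimately show ?thesis using reaches_While_exit[OF oc False] by blast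
    qed
  qed
qed

section \<open>Augmenting paths and breadth-first search\<close>

text \<open>Same coding as in \<open>holds_matching\<close>, with 0 for an unmatched agent, so that
  the arrays in memory can be used as \<open>ma\<close> directly.\<close>

definition matching_edges :: "(nat \<Rightarrow> nat) \<Rightarrow> edges" where
  "matching_edges ma = {{Agent j, Obj ob} | j ob. ma j = Suc ob}"

text \<open>This form suffices for the graphs of SDMT-1: \<open>A\<close> collects the agents with
  edges, and each of them has edges to exactly one of its classes, \<open>K j\<close>.\<close>

definition admitted_edges :: "nat set \<Rightarrow> (nat \<Rightarrow> nat set) \<Rightarrow> edges" where
  "admitted_edges A K = {{Agent j, Obj ob} | j ob. j \<in> A \<and> ob \<in> K j}"

lemma edge_eq_iff [simp]: "{Agent j, Obj ob} = {Agent j', Obj ob'} \<longleftrightarrow> j = j' \<and> ob = ob'"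
  by (auto simp: doubleton_eq_iff)

lemma edge_mem_matching_edges [simp]:
  "{Agent j, Obj ob} \<in> matching_edges ma \<longleftrightarrow> ma j = Suc ob"
  "{Obj ob, Agent j} \<in> matching_edges ma \<longleftrightarrow> ma j = Suc ob"
  by (auto simp: matching_edges_def insert_commute)

lemma edge_mem_admitted_edges [simp]:
  "{Agent j, Obj ob} \<in> admitted_edges A K \<longleftrightarrow> j \<in> A \<and> ob \<in> K j"
  "{Obj ob, Agent j} \<in> admitted_edges A K \<longleftrightarrow> j \<in> A \<and> ob \<in> K j"
  by (auto simp: admitted_edges_def insert_commute)

lemma admitted_edgesE:
  assumes "{Agent j, v} \<in> admitted_edges A K"
  obtains ob where "v = Obj ob" "ob \<in> K j"
  using assms by (auto simp: admitted_edges_def doubleton_eq_iff)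

lemma matching_edgesE:
  assumes "{Obj ob, v} \<in> matching_edges ma"
  obtains j where "v = Agent j" "ma j = Suc ob"
  using assms by (auto simp: matching_edges_def doubleton_eq_iff)

lemma object_uncovered_iff:
  "(\<forall>e\<in>matching_edges ma. Obj ob \<notin> e) \<longleftrightarrow> (\<forall>j. ma j \<noteq> Suc ob)"
proof
  assume "\<forall>e\<in>matching_edges ma. Obj ob \<notin> e"
  then show "\<forall>j. ma j \<noteq> Suc ob" using edge_mem_matching_edges(1) by blast
qed (auto simp: matching_edges_def)

section \<open>Lower bounds on the length of augmenting paths\<close>

text \<open>Think of \<open>S t\<close> as containing all agents within \<open>t\<close> alternating steps of \<open>i\<close>.\<close>

lemma augmenting_path_length_ge:
  assumes aug: "augmenting_path I (admitted_edges A K) (matching_edges ma) i p"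
    and inj: "\<And>j j' ob. ma j = Suc ob \<Longrightarrow> ma j' = Suc ob \<Longrightarrow> j = j'"
    and start: "i \<in> S 0"
    and closed: "\<And>t j ob. t < N \<Longrightarrow> j \<in> S t \<Longrightarrow> ob \<in> K j \<Longrightarrow> \<exists>j'\<in>S (Suc t). ma j' = Suc ob"
  shows "2 * N + 2 \<le> length p"
proof -
  have edges: "{p ! k, p ! Suc k} \<in> admitted_edges A K"
    "{p ! k, p ! Suc k} \<in> matching_edges ma \<longleftrightarrow> odd k" if "Suc k < length p" for k
    using aug that by (auto simp: augmenting_path_def)
  obtain f where f: "last p = Obj f" "\<And>j. ma j \<noteq> Suc f"
    using aug by (auto simp: augmenting_path_def object_uncovered_iff)
  have ne: "p \<noteq> []" "hd p = Agent i"
    using aug by (auto simp: augmenting_path_def)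
  have last: "Suc k < length p" if "k < length p" "p ! k \<noteq> Obj f" for k
  proof -
    have "Suc k \<noteq> length p" using that f(1) ne by (metis diff_Suc_1 last_conv_nth)
    then show ?thesis using that(1) by simp
  qed
  \<comment> \<open>Position \<open>2 * t\<close> holds an agent of \<open>S t\<close>. By
    closedness the next object is matched, so it differs from the free end \<open>f\<close>; the
    path must go on, along the matching edge to an agent of \<open>S (Suc t)\<close>.\<close>
  have "2 * t + 1 < length p \<and> (\<exists>j\<in>S t. p ! (2 * t) = Agent j)" if "t \<le> N" for t
    using that
  proof (induction t)
    case 0
    have "p ! 0 = Agent i" using ne by (simp add: hd_conv_nth)
    then show ?case using last[of 0] ne start by auto
  next
    case (Suc t)
    then obtain j where j: "2 * t + 1 < length p" "j \<in> S t" "p ! (2 * t) = Agent j"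
      by auto
    then obtain ob where ob: "p ! (2 * t + 1) = Obj ob" "ob \<in> K j"
      using edges(1)[of "2 * t"] by (auto elim: admitted_edgesE)
    obtain j' where j': "j' \<in> S (Suc t)" "ma j' = Suc ob"
      using closed[OF _ j(2) ob(2)] Suc.prems by auto
    have "Suc (2 * t + 1) < length p"
      using last[OF j(1)] ob(1) j'(2) f(2) by auto
    then obtain j'' where "p ! (2 * Suc t) = Agent j''" "ma j'' = Suc ob"
      using edges(2)[of "2 * t + 1"] ob(1) by (auto elim: matching_edgesE)
    then have "p ! (2 * Suc t) = Agent j'"
      using inj[OF j'(2)] by auto
    moreover from this have "Suc (2 * Suc t) < length p"
      using last[of "2 * Suc t"] \<open>Suc (2 * t + 1) < length p\<close> by simp
    ultimately show ?case using j'(1) by auto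
  qed
  from this[of N] show ?thesis by simp
qed

text \<open>For a constant closed set the previous bound holds for every \<open>N\<close>; taking
  \<open>N = length p\<close> is absurd.\<close>

lemma no_augmenting_path:
  assumes "\<And>j j' ob. ma j = Suc ob \<Longrightarrow> ma j' = Suc ob \<Longrightarrow> j = j'"
    and "i \<in> S"
    and "\<And>j ob. j \<in> S \<Longrightarrow> ob \<in> K j \<Longrightarrow> \<exists>j'\<in>S. ma j' = Suc ob"
  shows "\<not> augmenting_path I (admitted_edges A K) (matching_edges ma) i p"
proof
  assume "augmenting_path I (admitted_edges A K) (matching_edges ma) i p"
  then have "2 * length p + 2 \<le> length p"
    using assms by (rule augmenting_path_length_ge[where S = "\<lambda>_. S"])
  then show False by simp
qed

section \<open>Alternating paths and the effect of augmentation\<close>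

text \<open>
  The alternating path \<open>Agent (J 0), Obj (B 0), \<dots>, Agent (J D), Obj (B D)\<close> runs from the
  unmatched agent \<open>i\<close> to a free object.
\<close>

locale alternating_path =
  fixes i :: nat and ma mo :: "nat \<Rightarrow> nat" and K :: "nat \<Rightarrow> nat set"
    and D :: nat and J B :: "nat \<Rightarrow> nat"
  assumes inverse: "ma j = Suc ob \<longleftrightarrow> mo ob = Suc j"
    and matched: "ma j = Suc ob \<Longrightarrow> ob \<in> K j"
    and root: "J 0 = i" "ma i = 0"
    and inj: "inj_on J {..D}"
    and linked: "t < D \<Longrightarrow> ma (J (Suc t)) = Suc (B t)"
    and admitted: "t \<le> D \<Longrightarrow> B t \<in> K (J t)"
    and free: "mo (B D) = 0"
begin

lemma agent_eqD: "J s = J t \<Longrightarrow> s \<le> D \<Longrightarrow> t \<le> D \<Longrightarrow> s = t"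
  using inj by (auto dest: inj_onD)

lemma object_linked: "t < D \<Longrightarrow> mo (B t) = Suc (J (Suc t))"
  using linked inverse by blast

text \<open>Distinctness of the objects follows from that of the agents: \<open>B t\<close> with
  \<open>t < D\<close> is owned by \<open>J (Suc t)\<close>, and \<open>B D\<close> has no
  owner.\<close>

lemma object_eqD:
  assumes "B s = B t" "s \<le> D" "t \<le> D"
  shows "s = t"
proof -
  consider "s < D" "t < D" | "s = D" | "t = D" using assms by linarith
  then show ?thesis
  proof cases
    case 1
    then have "J (Suc s) = J (Suc t)" using assms(1) object_linked by (metis nat.inject)
    then show ?thesis using agent_eqD[of "Suc s" "Suc t"] 1 by simp
  next
    case 2
    then show ?thesis using assms free object_linked[of t] by (cases "t = D") auto
  next
    case 3
    then show ?thesis using assms free object_linked[of s] by (cases "s = D") auto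
  qed
qed

lemma matched_iff: "ma (J t) = Suc ob \<longleftrightarrow> 0 < t \<and> ob = B (t - 1)" if "t \<le> D"
  using root linked[of "t - 1"] that by (cases t) auto

lemma on_path_matched: "mo (B t) = Suc j \<longleftrightarrow> t < D \<and> j = J (Suc t)" if "t \<le> D"
  using object_linked[of t] free that by (cases "t = D") auto

definition path :: "vertex list" where
  "path = map (\<lambda>k. if even k then Agent (J (k div 2)) else Obj (B (k div 2))) [0..<2 * D + 2]"

lemma length_path [simp]: "length path = 2 * D + 2"
  by (simp add: path_def)

lemma nth_path:
  "k < 2 * D + 2 \<Longrightarrow> path ! k = (if even k then Agent (J (k div 2)) else Obj (B (k div 2)))"
  by (simp add: path_def del: upt_Suc)

lemma augmenting_path_path:
  assumes "B D < num_objects I" "\<And>t. t \<le> D \<Longrightarrow> J t \<in> A"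
  shows "augmenting_path I (admitted_edges A K) (matching_edges ma) i path"
proof -
  have ne: "path \<noteq> []" using length_path by force
  have "k = l" if "k < 2 * D + 2" "l < 2 * D + 2" "path ! k = path ! l" for k l
  proof -
    have eq: "(if even k then Agent (J (k div 2)) else Obj (B (k div 2))) =
        (if even l then Agent (J (l div 2)) else Obj (B (l div 2)))"
      using that(3) unfolding nth_path[OF that(1)] nth_path[OF that(2)] .
    then have "even k \<longleftrightarrow> even l" by (cases "even k"; cases "even l") simp_all
    moreover have "k div 2 \<le> D" "l div 2 \<le> D" using that by linarith+
    then have "k div 2 = l div 2"
      using eq agent_eqD[of "k div 2" "l div 2"] object_eqD[of "k div 2" "l div 2"]
      by (cases "even k"; cases "even l") simp_all
    ultimately show ?thesis by presburger
  qed
  then have "distinct path" unfolding distinct_conv_nth by auto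
  moreover have "hd path = Agent i"
    using nth_path[of 0] root ne by (simp add: hd_conv_nth)
  moreover have "last path = Obj (B D)"
    using nth_path[of "2 * D + 1"] ne by (simp add: last_conv_nth)
  moreover have "\<forall>e\<in>matching_edges ma. Obj (B D) \<notin> e"
    using free inverse by (auto simp: object_uncovered_iff)
  moreover have "{path ! k, path ! Suc k} \<in> admitted_edges A K \<and>
      ({path ! k, path ! Suc k} \<in> matching_edges ma \<longleftrightarrow> odd k)" if k: "Suc k < length path" for k
  proof (cases "even k")
    case True
    then obtain t where t: "k = 2 * t" by (rule evenE)
    with k have "t \<le> D" by simp
    have "ma (J t) \<noteq> Suc (B t)"
    proof
      assume "ma (J t) = Suc (B t)"
      then have "0 < t" "B t = B (t - 1)" using matched_iff[OF \<open>t \<le> D\<close>] by auto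
      moreover have "t - 1 \<le> D" using \<open>t \<le> D\<close> by simp
      ultimately show False using object_eqD[of t "t - 1"] \<open>t \<le> D\<close> by simp
    qed
    moreover have "path ! k = Agent (J t)" "path ! Suc k = Obj (B t)"
      using t k nth_path[of k] nth_path[of "Suc k"] by simp_all
    ultimately show ?thesis
      using True assms(2)[OF \<open>t \<le> D\<close>] admitted[OF \<open>t \<le> D\<close>] by simp
  next
    case False
    then obtain t where t: "k = 2 * t + 1" by (rule oddE)
    with k have "t < D" by simp
    have "B t \<in> K (J (Suc t))"
      using linked[OF \<open>t < D\<close>] matched by blast
    moreover have "path ! k = Obj (B t)" "path ! Suc k = Agent (J (Suc t))"
      using t k nth_path[of k] nth_path[of "Suc k"] by simp_all
    ultimately show ?thesis
      using False assms(2)[of "Suc t"] \<open>t < D\<close> linked[OF \<open>t < D\<close>] by simp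
  qed
  ultimately show ?thesis
    using assms(1) ne by (simp add: augmenting_path_def)
qed

lemma edge_mem_path_edges:
  "e \<in> path_edges path \<longleftrightarrow>
     (\<exists>t\<le>D. e = {Agent (J t), Obj (B t)}) \<or> (\<exists>t<D. e = {Agent (J (Suc t)), Obj (B t)})"
  (is "?L \<longleftrightarrow> ?R")
proof
  assume ?L
  then obtain k where k: "e = {path ! k, path ! Suc k}" "Suc k < length path"
    unfolding path_edges_def by blast
  show ?R
  proof (cases "even k")
    case True
    then obtain t where "k = 2 * t" by (rule evenE)
    then have "t \<le> D" "e = {Agent (J t), Obj (B t)}"
      using k nth_path[of k] nth_path[of "Suc k"] by simp_all
    then show ?thesis by blast
  next
    case False
    then obtain t where "k = 2 * t + 1" by (rule oddE)
    then have "t < D" "e = {Agent (J (Suc t)), Obj (B t)}"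
      using k nth_path[of k] nth_path[of "Suc k"] by (simp_all add: insert_commute)
    then show ?thesis by blast
  qed
next
  assume ?R
  then show ?L
  proof (elim disjE exE conjE)
    fix t assume "t \<le> D" "e = {Agent (J t), Obj (B t)}"
    then have "e = {path ! (2 * t), path ! Suc (2 * t)}" "Suc (2 * t) < length path"
      using nth_path[of "2 * t"] nth_path[of "Suc (2 * t)"] by simp_all
    then show ?L unfolding path_edges_def by blast
  next
    fix t assume "t < D" "e = {Agent (J (Suc t)), Obj (B t)}"
    then have "e = {path ! (2 * t + 1), path ! Suc (2 * t + 1)}" "Suc (2 * t + 1) < length path"
      using nth_path[of "2 * t + 1"] nth_path[of "Suc (2 * t + 1)"] by (simp_all add: insert_commute)
    then show ?L unfolding path_edges_def by blast
  qed
qed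

end

locale augmentation = alternating_path +
  fixes ma' mo' :: "nat \<Rightarrow> nat"
  assumes agents_on_path: "t \<le> D \<Longrightarrow> ma' (J t) = Suc (B t)"
    and agents_off_path: "j \<notin> J ` {..D} \<Longrightarrow> ma' j = ma j"
    and objects_on_path: "t \<le> D \<Longrightarrow> mo' (B t) = Suc (J t)"
    and objects_off_path: "ob \<notin> B ` {..D} \<Longrightarrow> mo' ob = mo ob"
begin

lemma inverse': "ma' j = Suc ob \<longleftrightarrow> mo' ob = Suc j"
proof (cases "j \<in> J ` {..D}")
  case True
  then obtain s where s: "s \<le> D" "j = J s" by blast
  show ?thesis
  proof (cases "ob \<in> B ` {..D}")
    case True
    then obtain t where "t \<le> D" "ob = B t" by blast
    then show ?thesis
      using s agents_on_path objects_on_path object_eqD[of s t] agent_eqD[of s t] by auto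
  next
    case False
    then have "ob \<noteq> B s" "ob \<noteq> B (s - 1)" using s by auto
    then show ?thesis
      using s agents_on_path[OF s(1)] objects_off_path[OF False] matched_iff[OF s(1)] inverse[of j ob]
      by auto
  qed
next
  case False
  show ?thesis
  proof (cases "ob \<in> B ` {..D}")
    case True
    then obtain t where t: "t \<le> D" "ob = B t" by blast
    then have "j \<noteq> J t" "t < D \<Longrightarrow> j \<noteq> J (Suc t)" using False by auto
    then show ?thesis
      using t False agents_off_path objects_on_path[OF t(1)] on_path_matched[OF t(1)] inverse[of j ob]
      by auto
  next
    case ob: False
    then show ?thesis using False agents_off_path objects_off_path inverse by simp
  qed
qed

text \<open>At the agent \<open>J s\<close> the path has the edge to \<open>B s\<close>, which is
  not in the matching, and for \<open>0 < s\<close> the edge to \<open>B (s - 1)\<close>, which is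
  its current matching edge. The symmetric difference exchanges the two.\<close>

lemma matching_edges': "matching_edges ma' = sym_diff (matching_edges ma) (path_edges path)"
proof -
  have edge: "ma' j = Suc ob \<longleftrightarrow>
      {Agent j, Obj ob} \<in> sym_diff (matching_edges ma) (path_edges path)" for j ob
  proof (cases "j \<in> J ` {..D}")
    case True
    then obtain s where s: "s \<le> D" "j = J s" by blast
    have "{Agent j, Obj ob} \<in> path_edges path \<longleftrightarrow> ob = B s \<or> 0 < s \<and> ob = B (s - 1)"
    proof
      assume "{Agent j, Obj ob} \<in> path_edges path"
      then consider t where "t \<le> D" "J s = J t" "ob = B t"
        | t where "t < D" "J s = J (Suc t)" "ob = B t"
        unfolding edge_mem_path_edges edge_eq_iff s(2) by blast
      then show "ob = B s \<or> 0 < s \<and> ob = B (s - 1)"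
        using agent_eqD s(1) by cases (metis, metis Suc_leI diff_Suc_1 zero_less_Suc)
    next
      assume "ob = B s \<or> 0 < s \<and> ob = B (s - 1)"
      then show "{Agent j, Obj ob} \<in> path_edges path"
      proof (elim disjE conjE)
        assume "0 < s" "ob = B (s - 1)"
        then have "s - 1 < D" "Suc (s - 1) = s" using s(1) by simp_all
        then show ?thesis
          using s(2) \<open>ob = B (s - 1)\<close> unfolding edge_mem_path_edges edge_eq_iff by metis
      qed (use s in \<open>auto simp: edge_mem_path_edges\<close>)
    qed
    moreover have "B s \<noteq> B (s - 1)" if "0 < s"
    proof
      assume "B s = B (s - 1)"
      then have "s = s - 1" by (rule object_eqD) (use s(1) in simp_all)
      then show False using that by linarith
    qed
    ultimately show ?thesis
      using s agents_on_path[OF s(1)] matched_iff[OF s(1), of ob] by auto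
  next
    case False
    then have "{Agent j, Obj ob} \<notin> path_edges path"
      by (auto simp: edge_mem_path_edges)
    then show ?thesis using agents_off_path[OF False] by simp
  qed
  show ?thesis
  proof (intro set_eqI iffI)
    fix e assume "e \<in> matching_edges ma'"
    then show "e \<in> sym_diff (matching_edges ma) (path_edges path)"
      unfolding matching_edges_def[of ma'] using edge by blast
  next
    fix e assume e: "e \<in> sym_diff (matching_edges ma) (path_edges path)"
    then obtain j ob where "e = {Agent j, Obj ob}"
      by (auto simp: matching_edges_def edge_mem_path_edges)
    then show "e \<in> matching_edges ma'" using e edge[of j ob] by simp
  qed
qed

text \<open>Only the root of the path was unmatched before, and every agent on it has a partner
  afterwards. This lets the main invariant identify the agents with edges in the graph with the
  matched agents.\<close>

lemma matched_agents': "{j. ma' j \<noteq> 0} = insert i {j. ma j \<noteq> 0}"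
proof -
  have "ma' j \<noteq> 0 \<longleftrightarrow> j = i \<or> ma j \<noteq> 0" for j
  proof (cases "j \<in> J ` {..D}")
    case True
    then obtain s where "s \<le> D" "j = J s" by blast
    then show ?thesis
      using agents_on_path[of s] root linked[of "s - 1"] by (cases s) auto
  next
    case False
    then show ?thesis using agents_off_path root(1) by force
  qed
  then show ?thesis by auto
qed

lemma admitted':
  assumes "ma' j = Suc ob"
  shows "ob \<in> K j"
proof (cases "j \<in> J ` {..D}")
  case True
  then show ?thesis using assms agents_on_path admitted by auto
next
  case False
  then show ?thesis using assms agents_off_path matched by simp
qed

end

context alternating_path
begin

text \<open>Invariant of the augmentation loop. The program follows parent pointers, so it rewrites
  the pairs from \<open>D\<close> down to 0; those from position \<open>s\<close> on are done, and
  \<open>s = Suc D\<close> is the state before the first update.\<close>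

definition augmented_from :: "nat \<Rightarrow> (nat \<Rightarrow> nat) \<Rightarrow> (nat \<Rightarrow> nat) \<Rightarrow> bool" where
  "augmented_from s ma' mo' \<longleftrightarrow>
     (\<forall>t. s \<le> t \<and> t \<le> D \<longrightarrow> ma' (J t) = Suc (B t) \<and> mo' (B t) = Suc (J t)) \<and>
     (\<forall>j. j \<notin> J ` {s..D} \<longrightarrow> ma' j = ma j) \<and> (\<forall>ob. ob \<notin> B ` {s..D} \<longrightarrow> mo' ob = mo ob)"

lemma augmented_from_start: "augmented_from (Suc D) ma mo"
  by (simp add: augmented_from_def)

text \<open>When the program arrives at \<open>J t\<close>, it can still read there the old partner,
  which it needs as the object of the parent.\<close>

lemma augmented_from_unchanged:
  assumes "augmented_from (Suc t) ma' mo'" "t \<le> D"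
  shows "ma' (J t) = ma (J t)"
proof -
  have "J t \<notin> J ` {Suc t..D}"
  proof
    assume "J t \<in> J ` {Suc t..D}"
    then obtain s where "J t = J s" "Suc t \<le> s" "s \<le> D" by auto
    then show False using agent_eqD[of t s] assms(2) by simp
  qed
  then show ?thesis using assms(1) by (simp add: augmented_from_def)
qed

lemma augmented_from_step:
  assumes "augmented_from (Suc t) ma' mo'" "t \<le> D"
  shows "augmented_from t (ma'(J t := Suc (B t))) (mo'(B t := Suc (J t)))"
proof -
  have ivl: "{t..D} = insert t {Suc t..D}" using assms(2) by auto
  have "(ma'(J t := Suc (B t))) (J s) = Suc (B s) \<and> (mo'(B t := Suc (J t))) (B s) = Suc (J s)"
    if "t \<le> s" "s \<le> D" for s
  proof (cases "s = t")
    case False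
    then have "J s \<noteq> J t" "B s \<noteq> B t" using that agent_eqD[of s t] object_eqD[of s t] by auto
    then show ?thesis using that False assms(1) by (simp add: augmented_from_def)
  qed simp
  then show ?thesis
    using assms(1) unfolding augmented_from_def ivl by simp
qed

lemma augmentation_if_augmented_from_0:
  assumes "augmented_from 0 ma' mo'"
  shows "augmentation i ma mo K D J B ma' mo'"
proof unfold_locales
  show "ma' (J t) = Suc (B t)" "mo' (B t) = Suc (J t)" if "t \<le> D" for t
    using assms that unfolding augmented_from_def by blast+
  have "{0..D} = {..D}" by auto
  then show "ma' j = ma j" if "j \<notin> J ` {..D}" for j
    using assms that unfolding augmented_from_def by simp
  show "mo' ob = mo ob" if "ob \<notin> B ` {..D}" for ob
    using assms that \<open>{0..D} = {..D}\<close> unfolding augmented_from_def by simp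
qed

end

section \<open>Breadth-first search with retained marks\<close>

text \<open>
  Breadth-first search from \<open>i\<close>. The queue \<open>Q\<close> lists the agents reached so far, also those
  of earlier failed searches from \<open>i\<close> (at depth 0), which need not be explored again because
  they cannot reach a free object. The first \<open>h\<close> entries have been dequeued, \<open>c\<close> is the agent
  being explored, \<open>F\<close> the set of agents explored completely, and \<open>S\<close> the set of objects of
  \<open>c\<close> seen so far.
\<close>

locale bfs =
  fixes i :: nat and ma mo :: "nat \<Rightarrow> nat" and K :: "nat \<Rightarrow> nat set"
    and par :: "nat \<Rightarrow> nat" and Q :: "nat list" and h c :: nat and F S :: "nat set"
    and d :: "nat \<Rightarrow> nat"
  assumes inverse: "\<And>j ob. ma j = Suc ob \<longleftrightarrow> mo ob = Suc j"
    and root: "ma i = 0"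
    and distinct: "distinct Q"
    and queue_matched: "j \<in> set Q \<Longrightarrow> ma j \<noteq> 0"
    and head: "h \<le> length Q"
    and current: "c \<notin> F" "insert c F = insert i (set (take h Q))"
    and explored: "j \<in> F \<Longrightarrow> ob \<in> K j \<Longrightarrow> \<exists>j'\<in>set Q. mo ob = Suc j' \<and> d j' \<le> Suc (d j)"
    and exploring: "ob \<in> S \<Longrightarrow> \<exists>j'\<in>set Q. mo ob = Suc j' \<and> d j' \<le> Suc (d c)"
    and depth_root: "d i = 0"
    and depth_current: "d c = 0 \<Longrightarrow> c = i"
    and depth_sorted: "sorted (map d Q)"
    and depth_le: "j \<in> set Q \<Longrightarrow> d j \<le> Suc (d c)"
    and depth_ge: "j \<in> set (drop h Q) \<Longrightarrow> 0 < d j \<and> d c \<le> d j"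
    and tree: "j \<in> set Q \<Longrightarrow> 0 < d j \<Longrightarrow> par j \<in> insert i (set Q) \<and> (d (par j) = 0 \<longrightarrow> par j = i) \<and>
                 d j = Suc (d (par j)) \<and> (\<exists>ob\<in>K (par j). ma j = Suc ob)"
begin

lemma root_notin: "i \<notin> set Q"
  using queue_matched root by blast

lemma current_mem: "c \<in> insert i (set Q)"
  using current(2) set_take_subset[of h Q] by blast

lemma bfs_skip:
  assumes "mo ob = Suc j'" "j' \<in> set Q"
  shows "bfs i ma mo K par Q h c F (insert ob S) d"
proof (rule bfs.intro)
  fix ob' assume "ob' \<in> insert ob S"
  then show "\<exists>j'\<in>set Q. mo ob' = Suc j' \<and> d j' \<le> Suc (d c)"
    using assms depth_le exploring by blast
qed (fact inverse root distinct queue_matched head current explored depth_root depth_current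
      depth_sorted depth_le depth_ge tree)+

text \<open>The new agent gets depth \<open>Suc (d c)\<close>, the largest that
  \<open>depth_le\<close> allows, so appending it keeps the queue sorted by depth.\<close>

lemma bfs_visit:
  assumes "mo ob = Suc j'" "j' \<notin> set Q" "ob \<in> K c"
  shows "bfs i ma mo K (par(j' := c)) (Q @ [j']) h c F (insert ob S) (d(j' := Suc (d c)))"
proof -
  have j': "ma j' = Suc ob" using assms(1) inverse by simp
  then have "j' \<noteq> i" using root by auto
  have F: "F \<subseteq> insert i (set Q)"
    using current(2) set_take_subset[of h Q] by blast
  have ne: "j \<noteq> j'" if "j \<in> insert i (set Q)" for j
    using that assms(2) \<open>j' \<noteq> i\<close> by blast
  note nec = ne[OF current_mem]
  show ?thesis
  proof (rule bfs.intro)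
    show "distinct (Q @ [j'])" using distinct assms(2) by simp
    show "h \<le> length (Q @ [j'])" using head by simp
    show "insert c F = insert i (set (take h (Q @ [j'])))" using current(2) head by simp
    show "(d(j' := Suc (d c))) i = 0" using \<open>j' \<noteq> i\<close> depth_root by simp
    show "c = i" if "(d(j' := Suc (d c))) c = 0"
      using that nec depth_current by simp
    show "ma j \<noteq> 0" if "j \<in> set (Q @ [j'])" for j
      using that queue_matched j' by auto
    have map: "map (d(j' := Suc (d c))) Q = map d Q"
      using assms(2) by auto
    show "sorted (map (d(j' := Suc (d c))) (Q @ [j']))"
      unfolding map_append map using depth_sorted depth_le by (auto simp: sorted_append)
    show "(d(j' := Suc (d c))) j \<le> Suc ((d(j' := Suc (d c))) c)" if "j \<in> set (Q @ [j'])" for j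
      using that nec depth_le by auto
    show "0 < (d(j' := Suc (d c))) j \<and> (d(j' := Suc (d c))) c \<le> (d(j' := Suc (d c))) j"
      if "j \<in> set (drop h (Q @ [j']))" for j
      using that nec depth_ge head by auto
    show "\<exists>l\<in>set (Q @ [j']). mo b = Suc l \<and> (d(j' := Suc (d c))) l \<le> Suc ((d(j' := Suc (d c))) j)"
      if "j \<in> F" "b \<in> K j" for j b
    proof -
      from explored[OF that] obtain l where "l \<in> set Q" "mo b = Suc l" "d l \<le> Suc (d j)" by blast
      then show ?thesis using ne[of l] ne[of j] F that(1) by auto
    qed
    show "\<exists>l\<in>set (Q @ [j']). mo b = Suc l \<and> (d(j' := Suc (d c))) l \<le> Suc ((d(j' := Suc (d c))) c)"
      if "b \<in> insert ob S" for b
    proof (cases "b = ob")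
      case False
      with that exploring obtain l where "l \<in> set Q" "mo b = Suc l" "d l \<le> Suc (d c)" by blast
      then show ?thesis using ne[of l] nec by auto
    qed (use assms nec in auto)
    show "(par(j' := c)) j \<in> insert i (set (Q @ [j'])) \<and>
        ((d(j' := Suc (d c))) ((par(j' := c)) j) = 0 \<longrightarrow> (par(j' := c)) j = i) \<and>
        (d(j' := Suc (d c))) j = Suc ((d(j' := Suc (d c))) ((par(j' := c)) j)) \<and>
        (\<exists>ob\<in>K ((par(j' := c)) j). ma j = Suc ob)"
      if "j \<in> set (Q @ [j'])" "0 < (d(j' := Suc (d c))) j" for j
    proof (cases "j = j'")
      case True
      then show ?thesis using nec current_mem assms j' depth_current by auto
    next
      case False
      with that have j: "j \<in> set Q" "0 < d j" by auto
      then have "par j \<noteq> j'" using tree ne by blast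
      then show ?thesis using False tree[OF j] by auto
    qed
  qed (fact inverse root current)+
qed

lemma bfs_next:
  assumes "K c \<subseteq> S" "h < length Q"
  shows "bfs i ma mo K par Q (Suc h) (Q ! h) (insert c F) {} d"
proof -
  have drop: "drop h Q = Q ! h # drop (Suc h) Q"
    using assms(2) by (simp add: Cons_nth_drop_Suc)
  have sorted: "sorted (map d (drop h Q))"
    using depth_sorted by (metis drop_map sorted_wrt_drop)
  have ge: "0 < d (Q ! h)" "d c \<le> d (Q ! h)"
    using depth_ge drop by auto
  have notin: "Q ! h \<notin> set (take h Q)"
    using distinct assms(2) by (auto simp: in_set_conv_nth distinct_conv_nth)
  show ?thesis
  proof (rule bfs.intro)
    show "Suc h \<le> length Q" using assms(2) by simp
    have "Q ! h \<noteq> i" using root_notin assms(2) nth_mem by blast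
    then show "Q ! h \<notin> insert c F" using current(2) notin by simp
    show "insert (Q ! h) (insert c F) = insert i (set (take (Suc h) Q))"
      using current(2) assms(2) by (auto simp: take_Suc_conv_app_nth)
    show "\<exists>l\<in>set Q. mo b = Suc l \<and> d l \<le> Suc (d j)" if "j \<in> insert c F" "b \<in> K j" for j b
      using that explored exploring assms(1) by blast
    show "d j \<le> Suc (d (Q ! h))" if "j \<in> set Q" for j
      using depth_le[OF that] ge by simp
    show "0 < d j \<and> d (Q ! h) \<le> d j" if "j \<in> set (drop (Suc h) Q)" for j
      using that depth_ge[of j] sorted drop by auto
    show "Q ! h = i" if "d (Q ! h) = 0" using that ge by simp
    show "\<exists>j'\<in>set Q. mo ob = Suc j' \<and> d j' \<le> Suc (d (Q ! h))" if "ob \<in> {}" for ob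
      using that by simp
  qed (fact inverse root distinct queue_matched depth_root depth_sorted tree)+
qed

lemma matching_inj: "ma j = Suc ob \<Longrightarrow> ma j' = Suc ob \<Longrightarrow> j = j'"
  using inverse by simp

text \<open>The owners lie in the queue itself, which does not contain \<open>i\<close>. Hence the
  queue stays closed when the class of \<open>i\<close> is replaced; this is what the next search
  starts from.\<close>

lemma queue_closed:
  assumes "K c \<subseteq> S" "h = length Q" "j \<in> insert i (set Q)" "ob \<in> K j"
  shows "\<exists>j'\<in>set Q. mo ob = Suc j'"
proof -
  have "j \<in> insert c F" using assms(2,3) current(2) by simp
  then show ?thesis using explored exploring assms(1,4) by blast
qed

lemma bfs_fail:
  assumes "K c \<subseteq> S" "h = length Q"
  shows "\<not> augmenting_path I (admitted_edges A K) (matching_edges ma) i p"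
proof (rule no_augmenting_path[where S = "insert i (set Q)"])
  show "\<exists>j'\<in>insert i (set Q). ma j' = Suc ob" if "j \<in> insert i (set Q)" "ob \<in> K j" for j ob
    using queue_closed[OF assms that] inverse by blast
  show "j = j'" if "ma j = Suc ob" "ma j' = Suc ob" for j j' ob
    using that by (rule matching_inj)
qed simp

text \<open>The layers are the sets of reached agents of depth at most \<open>t\<close>. Agents of
  earlier failed searches sit in layer 0; understating their depth does no harm, since the layers
  need only be closed.\<close>

lemma augmenting_path_length_ge_depth:
  assumes "augmenting_path I (admitted_edges A K) (matching_edges ma) i p"
  shows "2 * d c + 2 \<le> length p"
proof (rule augmenting_path_length_ge[OF assms, where S = "\<lambda>t. {j \<in> insert i (set Q). d j \<le> t}"])
  show "j = j'" if "ma j = Suc ob" "ma j' = Suc ob" for j j' ob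
    using that by (rule matching_inj)
  show "i \<in> {j \<in> insert i (set Q). d j \<le> 0}" using depth_root by simp
  fix t j ob
  assume t: "t < d c" and j: "j \<in> {j \<in> insert i (set Q). d j \<le> t}" and ob: "ob \<in> K j"
  \<comment> \<open>Agents still waiting have depth at least \<open>d c\<close>, so an agent of
    smaller depth has been explored completely.\<close>
  have "j \<notin> set (drop h Q)" using depth_ge[of j] t j by auto
  moreover have "set Q = set (take h Q) \<union> set (drop h Q)"
    by (metis append_take_drop_id set_append)
  ultimately have "j \<in> insert c F" using j current(2) by auto
  then have "j \<in> F" using t j by auto
  from explored[OF this ob] obtain j' where "j' \<in> set Q" "mo ob = Suc j'" "d j' \<le> Suc (d j)"
    by blast
  then show "\<exists>j'\<in>{j \<in> insert i (set Q). d j \<le> Suc t}. ma j' = Suc ob"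
    using j inverse by auto
qed

text \<open>Indexed by depth, from \<open>i\<close> at 0 to \<open>c\<close> at \<open>d c\<close>,
  to fit the sequence \<open>J\<close> of \<open>alternating_path\<close>.\<close>

definition ancestor :: "nat \<Rightarrow> nat" where
  "ancestor t = (par ^^ (d c - t)) c"

lemma ancestor_top: "ancestor (d c) = c"
  by (simp add: ancestor_def)

lemma ancestor_Suc:
  assumes "t < d c"
  shows "ancestor t = par (ancestor (Suc t))"
proof -
  have "d c - t = Suc (d c - Suc t)" using assms by simp
  then show ?thesis by (simp only: ancestor_def funpow.simps comp_def)
qed

text \<open>Depth 0 alone does not identify \<open>i\<close>, because agents of earlier searches
  share it. The clauses about depth 0 in \<open>depth_current\<close> and \<open>tree\<close>
  prevent a chain of parents from ending in one of those.\<close>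

lemma ancestor_mem:
  assumes "t \<le> d c"
  shows "ancestor t \<in> insert i (set Q) \<and> d (ancestor t) = t \<and> (t = 0 \<longrightarrow> ancestor t = i)"
  using assms
proof (induction rule: inc_induct)
  case base
  show ?case unfolding ancestor_top using current_mem depth_current by auto
next
  case (step t)
  then have "ancestor (Suc t) \<in> set Q" "0 < d (ancestor (Suc t))"
    using depth_root by auto
  from tree[OF this] show ?case using step.IH step.hyps unfolding ancestor_Suc[OF step.hyps(2)]
    by auto
qed

text \<open>The objects on the path need not be stored: the one following \<open>ancestor t\<close>
  is the partner of \<open>ancestor (Suc t)\<close>, and subtracting 1 decodes it.\<close>

lemma bfs_found:
  assumes "ob \<in> K c" "mo ob = 0" "\<And>j ob. ma j = Suc ob \<Longrightarrow> ob \<in> K j"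
  shows "alternating_path i ma mo K (d c) ancestor
           (\<lambda>t. if t = d c then ob else ma (ancestor (Suc t)) - 1)"
proof
  show "ancestor 0 = i" using ancestor_mem[of 0] by simp
  show "inj_on ancestor {..d c}"
    by (rule inj_on_inverseI[where g = d]) (simp add: ancestor_mem)
  have linked: "\<exists>b\<in>K (ancestor t). ma (ancestor (Suc t)) = Suc b" if "t < d c" for t
  proof -
    have "ancestor (Suc t) \<in> set Q" "0 < d (ancestor (Suc t))"
      using ancestor_mem[of "Suc t"] that depth_root by auto
    from tree[OF this] show ?thesis using that by (simp add: ancestor_Suc)
  qed
  show "ma (ancestor (Suc t)) = Suc (if t = d c then ob else ma (ancestor (Suc t)) - 1)"
    if "t < d c" for t
    using linked[OF that] that by auto
  show "(if t = d c then ob else ma (ancestor (Suc t)) - 1) \<in> K (ancestor t)" if "t \<le> d c" for t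
    using linked[of t] that assms(1) by (auto simp: ancestor_top)
  show "ob' \<in> K j" if "ma j = Suc ob'" for j ob'
    using assms(3) that .
  show "ma j = Suc b \<longleftrightarrow> mo b = Suc j" for j b by (fact inverse)
  show "ma i = 0" by (fact root)
  show "mo (if d c = d c then ob else ma (ancestor (Suc (d c))) - 1) = 0" using assms(2) by simp
qed

end

text \<open>The whole old queue counts as dequeued and explored, so the search for a new class
  begins with \<open>i\<close> itself being explored and nobody waiting.\<close>

lemma bfs_start:
  assumes inverse: "\<And>j ob. ma j = Suc ob \<longleftrightarrow> mo ob = Suc j" and root: "ma i = 0" and "distinct Q"
    and queue_matched: "\<And>j. j \<in> set Q \<Longrightarrow> ma j \<noteq> 0"
    and closed: "\<And>j ob. j \<in> set Q \<Longrightarrow> ob \<in> K j \<Longrightarrow> \<exists>j'\<in>set Q. mo ob = Suc j'"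
  shows "bfs i ma mo K par Q (length Q) i (set Q) {} (\<lambda>_. 0)"
proof (rule bfs.intro)
  show "i \<notin> set Q" using root queue_matched by blast
  show "sorted (map (\<lambda>_. 0 :: nat) Q)" by (simp add: sorted_iff_nth_mono)
  show "\<exists>j'\<in>set Q. mo ob = Suc j' \<and> (0 :: nat) \<le> Suc 0" if "j \<in> set Q" "ob \<in> K j" for j ob
    using closed[OF that] by simp
  show "ma j \<noteq> 0" if "j \<in> set Q" for j using that by (rule queue_matched)
  show "ma j = Suc ob \<longleftrightarrow> mo ob = Suc j" for j ob by (fact inverse)
  show "ma i = 0" "distinct Q" by fact+
qed simp_all

section \<open>The program and its correctness\<close>

text \<open>
  Registers: 0 and 3--8 hold the base addresses of the arrays below, 1 the constant 1, 2 the number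
  of agents, 24 the constant 0; 9 is the address of the current agent in the input order, 10 the
  end of that order, 11 the current agent, 12 the number of its classes not yet tried, 13 the
  address of the next one; 14 and 15 are the head and the tail of the queue, 16 the agent being
  explored, 17 and 18 delimit its unscanned objects, 19 is the loop flag, 20 tells whether a free
  object was found, and 21 is the current object. The others are temporary. The queue survives
  from one class of the current agent to the next; an agent has been visited iff its time stamp
  equals register 9.
\<close>

abbreviation fetch_object :: "instr list" where
  "fetch_object \<equiv> [Load 21 17, Add 23 8 21, Load 22 23]"

abbreviation check_owner :: "instr list" where
  "check_owner \<equiv> [Add 17 17 1, Sub 22 22 1, Add 23 5 22, Load 28 23]"

abbreviation enqueue_owner :: "instr list" where
  "enqueue_owner \<equiv> [Store 23 9, Add 23 6 22, Store 23 16, Add 23 7 15, Store 23 22, Add 15 15 1]"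

abbreviation report_free :: "instr list" where
  "report_free \<equiv> [Const 20 1, Const 19 0]"

abbreviation dequeue_agent :: "instr list" where
  "dequeue_agent \<equiv> [Add 23 7 14, Load 16 23, Add 14 14 1, Add 23 4 16, Load 17 23, Load 18 17,
    Add 17 17 1, Add 18 18 17]"

text \<open>The machine tests only \<open><\<close>. Since no stamp ever exceeds register 9, a stamp
  below it is the same as a stamp different from it.\<close>

definition scan_code :: com where
  "scan_code =
     Block fetch_object ;;
     If_less 24 22
       (Block check_owner ;; If_less 28 9 (Block enqueue_owner) (Block []))
       (Block report_free)"

definition advance_code :: com where
  "advance_code = If_less 14 15 (Block dequeue_agent) (Block [Const 19 0])"

definition search_code :: com where
  "search_code = While_less 24 19 (If_less 17 18 scan_code advance_code)"

text \<open>The old partner is read before it is overwritten: it becomes the object of the parent,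
  and the value 0 reveals the root.\<close>

definition augment_code :: com where
  "augment_code =
     Block [Const 19 1] ;;
     While_less 24 19
       (Block [Add 23 0 16, Load 22 23, Add 28 21 1, Store 23 28, Add 23 8 21, Add 28 16 1, Store 23 28] ;;
        If_less 24 22
          (Block [Sub 21 22 1, Add 23 6 16, Load 16 23])
          (Block [Const 19 0]))"

text \<open>The queue is emptied without touching the stamps: register 9 has been raised before this
  code runs, which makes all of them stale.\<close>

definition load_code :: com where
  "load_code =
     If_less 9 10
       (Block [Load 11 9, Add 23 3 11, Load 23 23, Load 12 23, Add 13 23 1, Const 14 0, Const 15 0])
       (Block [])"

text \<open>One pass is exactly one \<open>sdmt1_step\<close>, so the successive states of SDMT-1
  are those at the head of the main loop.\<close>

definition step_code :: com where
  "step_code =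
     If_less 24 12
       (Block [Add 23 4 11, Store 23 13, Add 16 11 24, Load 18 13, Add 17 13 1, Add 18 18 17,
               Const 19 1, Const 20 0] ;;
        search_code ;;
        If_less 24 20
          (augment_code ;; Block [Add 9 9 1] ;; load_code)
          (Block [Load 23 13, Add 13 13 23, Add 13 13 1, Sub 12 12 1]))
       (Block [Add 9 9 1] ;; load_code)"

definition skip_code :: com where
  "skip_code =
     Block [Load 27 25, Add 25 25 1] ;;
     While_less 24 27 (Block [Load 23 25, Add 25 25 23, Add 25 25 1, Sub 27 27 1])"

text \<open>The lists are traversed twice: first to find the end of the input, behind which the
  arrays are placed, then to enter the addresses of the lists into one of these arrays.\<close>

definition init_code :: com where
  "init_code =
     Block [Const 1 1, Load 2 24, Const 10 2, Add 10 10 2, Const 26 0, Add 25 10 24] ;;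
     While_less 26 2 (skip_code ;; Block [Add 26 26 1]) ;;
     Block [Add 0 25 24, Add 3 25 2, Add 4 3 2, Add 5 4 2, Add 6 5 2, Add 7 6 2, Add 8 7 2,
            Const 26 0, Add 25 10 24] ;;
     While_less 26 2 (Block [Add 23 3 26, Store 23 25] ;; skip_code ;; Block [Add 26 26 1]) ;;
     Block [Const 9 2] ;;
     load_code"

definition sdmt_program :: "instr list" where
  "sdmt_program = compile 0 (init_code ;; While_less 9 10 step_code)"

section \<open>Memory layout\<close>

locale sdmt_input =
  fixes I :: instance_ha and \<sigma> :: "nat list" and ls :: "nat list list list" and w :: "nat list"
  assumes ha: "ha_instance I"
    and order: "agent_order I \<sigma>"
    and length_ls: "length ls = num_agents I"
    and classes: "i < num_agents I \<Longrightarrow> map set (ls ! i) = pref I i"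
    and distinct_classes: "i < num_agents I \<Longrightarrow> xs \<in> set (ls ! i) \<Longrightarrow> distinct xs"
    and word: "w = [num_agents I, num_objects I] @ \<sigma> @ concat (map agent_word ls)"
begin

abbreviation "n \<equiv> num_agents I"
abbreviation "\<gamma> \<equiv> max_class_size I"

text \<open>
  Behind the input the memory holds seven arrays, all but the last one indexed by the agents:
  0: the matching, 1: the addresses of the preference lists, 2: the address of the class that
  the graph contains for an agent, 3: the time stamp of the last visit, 4: the parent in the
  search tree, 5: the queue, 6: the matching seen from the objects.
\<close>

definition base :: "nat \<Rightarrow> nat" where
  "base k = length w + k * n"

text \<open>The default 0 turns an agent array into a total function; in particular
  \<open>arr 0 m\<close> treats every number that is no agent as unmatched. Array 6 is unbounded
  because nothing is stored behind it.\<close>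

definition arr :: "nat \<Rightarrow> (nat \<Rightarrow> nat) \<Rightarrow> nat \<Rightarrow> nat" where
  "arr k m j = (if j < n \<or> k = 6 then m (base k + j) else 0)"

definition input_intact :: "(nat \<Rightarrow> nat) \<Rightarrow> bool" where
  "input_intact m \<longleftrightarrow> (\<forall>a<length w. m a = w ! a)"

definition fixed_regs :: "(nat \<Rightarrow> nat) \<Rightarrow> bool" where
  "fixed_regs r \<longleftrightarrow>
     r 0 = base 0 \<and> r 1 = 1 \<and> r 2 = n \<and> r 3 = base 1 \<and> r 4 = base 2 \<and> r 5 = base 3 \<and>
     r 6 = base 4 \<and> r 7 = base 5 \<and> r 8 = base 6 \<and> r 10 = n + 2 \<and> r 24 = 0"

text \<open>The set of members of the class whose \<open>class_word\<close> starts at address \<open>x\<close>.\<close>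

definition members :: "nat \<Rightarrow> nat set" where
  "members x = (!) w ` {x<..x + w ! x}"

definition class_address :: "nat \<Rightarrow> bool" where
  "class_address x \<longleftrightarrow> x + w ! x < length w \<and> w ! x \<le> \<gamma> \<and> members x \<subseteq> {..<num_objects I}"

definition queue :: "(nat \<Rightarrow> nat) \<Rightarrow> nat \<Rightarrow> nat list" where
  "queue m t = map (arr 5 m) [0..<t]"

lemma length_queue [simp]: "length (queue m t) = t"
  by (simp add: queue_def)

lemma arr_read: "j < n \<or> k = 6 \<Longrightarrow> m (base k + j) = arr k m j"
  by (simp add: arr_def)

lemma base_neq:
  assumes "k < k'" "j < n"
  shows "base k + j \<noteq> base k' + j'"
proof -
  have "k * n + n \<le> k' * n" using assms(1) mult_le_mono1[of "Suc k" k' n] by simp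
  then show ?thesis using assms(2) by (simp add: base_def)
qed

lemma arr_upd:
  assumes "j < n \<or> k = 6" "k \<le> 6" "k' \<le> 6"
  shows "arr k' (m(base k + j := v)) = (if k = k' then (arr k m)(j := v) else arr k' m)"
proof
  fix j'
  have "k < k' \<Longrightarrow> j < n" "k' < k \<Longrightarrow> j' < n \<or> k' = 6 \<Longrightarrow> j' < n"
    using assms by auto
  then have "k \<noteq> k' \<Longrightarrow> j' < n \<or> k' = 6 \<Longrightarrow> base k + j \<noteq> base k' + j'"
    using base_neq[of k k' j j'] base_neq[of k' k j' j] by (metis linorder_neqE_nat)
  then show "arr k' (m(base k + j := v)) j' = (if k = k' then (arr k m)(j := v) else arr k' m) j'"
    using assms(1) unfolding arr_def by auto
qed

lemma input_intact_upd: "input_intact m \<Longrightarrow> input_intact (m(base k + j := v))"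
  by (simp add: input_intact_def base_def)

lemma queue_upd: "k \<le> 6 \<Longrightarrow> k \<noteq> 5 \<Longrightarrow> j < n \<or> k = 6 \<Longrightarrow> queue (m(base k + j := v)) t = queue m t"
  by (simp add: queue_def arr_upd)

lemma queue_push: "t < n \<Longrightarrow> queue (m(base 5 + t := v)) (Suc t) = queue m t @ [v]"
  by (simp add: queue_def arr_upd)

lemma arr_positive: "arr 0 m j \<noteq> 0 \<Longrightarrow> j < n"
  by (auto simp: arr_def split: if_splits)

section \<open>Correctness and cost of search and augmentation\<close>

text \<open>
  The search is entered with register contents \<open>r0\<close>; \<open>R\<close> credits are left over for what
  follows.
\<close>

definition search_inv ::
  "nat \<Rightarrow> (nat \<Rightarrow> nat) \<Rightarrow> (nat \<Rightarrow> nat) \<Rightarrow> (nat \<Rightarrow> nat) \<Rightarrow> (nat \<Rightarrow> nat) \<Rightarrow> (nat \<Rightarrow> nat) \<Rightarrow> nat \<Rightarrow>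
   (nat \<Rightarrow> nat) \<Rightarrow> (nat \<Rightarrow> nat) \<Rightarrow> nat \<Rightarrow> bool" where
  "search_inv i ma mo cl st r0 R r m k \<longleftrightarrow>
     fixed_regs r \<and> input_intact m \<and>
     arr 0 m = ma \<and> arr 1 m = st \<and> arr 2 m = cl \<and> arr 6 m = mo \<and>
     r 9 = r0 9 \<and> r 11 = r0 11 \<and> r 12 = r0 12 \<and> r 13 = r0 13 \<and>
     (\<forall>j. arr 3 m j \<le> r 9) \<and> (\<forall>j. arr 3 m j = r 9 \<longleftrightarrow> j \<in> set (queue m (r 15))) \<and>
     (\<exists>F S d. bfs i ma mo (members \<circ> cl) (arr 4 m) (queue m (r 15)) (r 14) (r 16) F S d \<and>
        (r 20 = 0 \<and> r 19 = 1 \<and> cl (r 16) < r 17 \<and> r 17 \<le> r 18 \<and>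
           r 18 = Suc (cl (r 16) + w ! cl (r 16)) \<and> S = (!) w ` {cl (r 16)<..<r 17} \<and>
           25 * ((n - r 14) * (1 + \<gamma>) + (r 18 - r 17) + 1) + 2 + R \<le> k \<or>
         r 20 = 0 \<and> r 19 = 0 \<and> members (cl (r 16)) \<subseteq> S \<and> r 14 = r 15 \<and>
           25 * ((n - r 14) * (1 + \<gamma>)) + 2 + R \<le> k \<or>
         r 20 = 1 \<and> r 19 = 0 \<and> r 21 \<in> members (cl (r 16)) \<and> mo (r 21) = 0 \<and> 2 + R \<le> k))"

text \<open>The cases of the invariant are: still searching, failed, found. While searching, every
  agent not yet dequeued holds \<open>25 * (1 + \<gamma>)\<close> credits, for dequeuing it once and
  scanning at most \<open>\<gamma>\<close> objects. The longest iteration, in which an owner is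
  enqueued, takes 21 steps. The extra unit pays for noticing that the queue is empty, the 2 for
  leaving the loop.\<close>

lemma wp_search:
  assumes "search_inv i ma mo cl st r0 R r m k" and "i < n"
    and cl: "\<And>j. j = i \<or> ma j \<noteq> 0 \<Longrightarrow> class_address (cl j)"
    and post: "\<And>r m k. search_inv i ma mo cl st r0 R r m (k + 2) \<Longrightarrow> r 19 = 0 \<Longrightarrow> Q r m k"
  shows "wp search_code Q r m k"
  unfolding search_code_def
proof (rule wp_While_less[where Inv = "search_inv i ma mo cl st r0 R"])
  show "search_inv i ma mo cl st r0 R r m k" by fact
next
  fix r m k
  assume inv: "search_inv i ma mo cl st r0 R r m k" and go: "\<not> r 24 < r 19"
  then have "2 \<le> k" "r 19 = 0" by (auto simp: search_inv_def fixed_regs_def)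
  moreover from this have "k - 2 + 2 = k" by simp
  ultimately show "2 \<le> k \<and> Q r m (k - 2)" using inv post[of r m "k - 2"] by simp
next
  fix r m k
  assume inv: "search_inv i ma mo cl st r0 R r m k" and go: "r 24 < r 19"
  then have regs: "fixed_regs r" and intact: "input_intact m"
    and arrs: "arr 0 m = ma" "arr 1 m = st" "arr 2 m = cl" "arr 6 m = mo"
    and r0: "r 9 = r0 9" "r 11 = r0 11" "r 12 = r0 12" "r 13 = r0 13"
    and vis: "\<And>j. arr 3 m j \<le> r 9" "\<And>j. arr 3 m j = r 9 \<longleftrightarrow> j \<in> set (queue m (r 15))"
    unfolding search_inv_def by blast+
  note R = regs[unfolded fixed_regs_def]
  from inv go obtain F S d where
    bfs: "bfs i ma mo (members \<circ> cl) (arr 4 m) (queue m (r 15)) (r 14) (r 16) F S d"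
    and loop: "r 20 = 0" "r 19 = 1" "cl (r 16) < r 17" "r 17 \<le> r 18"
      "r 18 = Suc (cl (r 16) + w ! cl (r 16))" "S = (!) w ` {cl (r 16)<..<r 17}"
    and k: "25 * ((n - r 14) * (1 + \<gamma>) + (r 18 - r 17) + 1) + 2 + R \<le> k"
    unfolding search_inv_def by auto
  interpret bfs i ma mo "members \<circ> cl" "arr 4 m" "queue m (r 15)" "r 14" "r 16" F S d
    by (fact bfs)
  have agent: "j < n" if "ma j \<noteq> 0" for j
    using that arr_positive arrs(1) by blast
  have c: "r 16 = i \<or> ma (r 16) \<noteq> 0"
    using current_mem queue_matched by blast
  then have "r 16 < n" using agent \<open>i < n\<close> by blast
  have "set (queue m (r 15)) \<subseteq> {..<n}"
    using queue_matched agent by blast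
  \<comment> \<open>The queue has no repetitions and contains only agents, so it never outgrows its
    array.\<close>
  then have tail: "r 15 \<le> n"
    using distinct distinct_card[of "queue m (r 15)"] card_mono[of "{..<n}" "set (queue m (r 15))"] by simp
  have "26 \<le> k" using k by simp
  let ?I = "search_inv i ma mo cl st r0 R"
  have scan_code: "wp scan_code ?I r m (k - 4)" if scan: "r 17 < r 18"
  proof -
    define ob where "ob = w ! r 17"
    have "class_address (cl (r 16))" using cl c by blast
    then have "r 17 < length w" using scan loop(5) by (simp add: class_address_def)
    then have ob: "m (r 17) = ob" using intact by (simp add: input_intact_def ob_def)
    have ob_mem: "ob \<in> members (cl (r 16))"
      using scan loop(3,5) by (auto simp: ob_def members_def)
    define r1 where "r1 = r(21 := ob, 23 := base 6 + ob, 22 := mo ob)"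
    have r1: "effects fetch_object (r, m) = (r1, m)"
      using R ob arrs(4) by (simp add: r1_def arr_read)
    have ivl: "{cl (r 16)<..<Suc (r 17)} = insert (r 17) {cl (r 16)<..<r 17}"
      using loop(3) by auto
    have S': "insert ob S = (!) w ` {cl (r 16)<..<Suc (r 17)}"
      unfolding ivl loop(6) by (simp add: ob_def)
    have "r 18 - r 17 = Suc (r 18 - Suc (r 17))" using scan by simp
    then have k': "25 * ((n - r 14) * (1 + \<gamma>) + (r 18 - Suc (r 17)) + 1) + 2 + R + 25 \<le> k"
      using k by simp
    have "wp (If_less 24 22 (Block check_owner ;; If_less 28 9 (Block enqueue_owner) (Block []))
        (Block report_free)) ?I r1 m (k - 7)"
    proof (rule wp_If_less)
      assume "r1 24 < r1 22"
      then have "0 < mo ob" using R by (simp add: r1_def)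
      then obtain j where j: "mo ob = Suc j" using gr0_conv_Suc by blast
      then have "ma j = Suc ob" using inverse by simp
      then have "j < n" using agent by simp
      define r2 where "r2 = r1(17 := Suc (r 17), 22 := j, 23 := base 3 + j, 28 := arr 3 m j)"
      have r2: "effects check_owner (r1, m) = (r2, m)"
        using R j \<open>j < n\<close> by (simp add: r1_def r2_def arr_read)
      have "wp (If_less 28 9 (Block enqueue_owner) (Block [])) ?I r2 m (k - 13)"
      proof (rule wp_If_less)
        assume "r2 28 < r2 9"
        then have notin: "j \<notin> set (queue m (r 15))"
          using vis(2)[of j] by (simp add: r1_def r2_def)
        have "card (insert j (set (queue m (r 15)))) \<le> card {..<n}"
          using \<open>set (queue m (r 15)) \<subseteq> {..<n}\<close> \<open>j < n\<close> by (intro card_mono) auto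
        then have "r 15 < n"
          using notin distinct distinct_card[of "queue m (r 15)"] by simp
        define m' where "m' = m(base 3 + j := r 9, base 4 + j := r 16, base 5 + r 15 := j)"
        have m': "arr 0 m' = ma" "arr 1 m' = st" "arr 2 m' = cl" "arr 6 m' = mo"
          "arr 3 m' = (arr 3 m)(j := r 9)" "arr 4 m' = (arr 4 m)(j := r 16)"
          "queue m' (Suc (r 15)) = queue m (r 15) @ [j]" "input_intact m'"
          using arrs \<open>j < n\<close> \<open>r 15 < n\<close> intact
          by (simp_all add: m'_def arr_upd queue_push queue_upd input_intact_upd)
        define r3 where "r3 = r2(23 := base 5 + r 15, 15 := Suc (r 15))"
        have r3: "effects enqueue_owner (r2, m) = (r3, m')"
          using R by (simp add: r1_def r2_def r3_def m'_def)
        have "bfs i ma mo (members \<circ> cl) (arr 4 m') (queue m' (r3 15)) (r3 14) (r3 16) F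
            (insert ob S) (d(j := Suc (d (r 16))))"
          using bfs_visit[OF j notin] ob_mem m' by (simp add: r1_def r2_def r3_def)
        moreover have "fixed_regs r3" using R by (simp add: fixed_regs_def r1_def r2_def r3_def)
        ultimately have "?I r3 m' (k - 21)"
          unfolding search_inv_def
          using m' r0 vis loop scan S' k' by (auto simp: r1_def r2_def r3_def)
        then show "wp (Block enqueue_owner) ?I r2 m (k - 13 - 2)"
          using k' by (intro wp_Block[OF r3]) simp_all
      next
        assume "\<not> r2 28 < r2 9"
        then have "j \<in> set (queue m (r 15))"
          using vis(1)[of j] vis(2)[of j] by (simp add: r1_def r2_def)
        then have "bfs i ma mo (members \<circ> cl) (arr 4 m) (queue m (r2 15)) (r2 14) (r2 16) F
            (insert ob S) d"
          using bfs_skip[OF j] by (simp add: r1_def r2_def)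
        moreover have "fixed_regs r2" using R by (simp add: fixed_regs_def r1_def r2_def)
        ultimately have "?I r2 m (k - 15)"
          unfolding search_inv_def
          using arrs intact r0 vis loop scan S' k' by (auto simp: r1_def r2_def)
        then show "wp (Block []) ?I r2 m (k - 13 - 2)"
          by (intro wp_Block) simp_all
      qed (use k' in simp)
      then show "wp (Block check_owner ;; If_less 28 9 (Block enqueue_owner) (Block [])) ?I r1 m
          (k - 7 - 2)"
        using k' by (intro wp_Block_Seq[OF r2]) simp_all
    next
      assume "\<not> r1 24 < r1 22"
      then have "mo ob = 0" using R by (simp add: r1_def)
      moreover have "fixed_regs (r1(20 := 1, 19 := 0))" using R by (simp add: fixed_regs_def r1_def)
      ultimately have "?I (r1(20 := 1, 19 := 0)) m (k - 11)"
        unfolding search_inv_def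
        using arrs intact r0 vis bfs ob_mem k' by (auto simp: r1_def)
      then show "wp (Block report_free) ?I r1 m (k - 7 - 2)"
        using k' by (intro wp_Block) simp_all
    qed (use k' in simp)
    then show ?thesis
      unfolding scan_code_def using k' by (intro wp_Block_Seq[OF r1]) simp_all
  qed
  have advance_code: "wp advance_code ?I r m (k - 4)" if finished: "\<not> r 17 < r 18"
    unfolding advance_code_def
  proof (rule wp_If_less)
    show "2 \<le> k - 4" using k by simp
  next
    have "r 17 = r 18" using finished loop(4) by simp
    then have all: "members (cl (r 16)) \<subseteq> S"
      unfolding loop(5,6) members_def by (auto simp: less_Suc_eq_le)
    {
      assume less: "r 14 < r 15"
      define j where "j = queue m (r 15) ! r 14"
      have j: "j \<in> set (queue m (r 15))" using less by (simp add: j_def)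
      then have "ma j \<noteq> 0" using queue_matched by blast
      then have "j < n" "class_address (cl j)" using agent cl by blast+
      have "m (base 5 + r 14) = j"
        using less tail by (simp add: j_def queue_def arr_read)
      moreover have "m (cl j) = w ! cl j"
        using \<open>class_address (cl j)\<close> intact by (simp add: class_address_def input_intact_def)
      moreover have "m (base 2 + j) = cl j"
        using \<open>j < n\<close> arrs by (simp add: arr_read)
      moreover define r1 where "r1 = r(23 := base 2 + j, 16 := j, 14 := Suc (r 14),
        17 := Suc (cl j), 18 := w ! cl j + Suc (cl j))"
      ultimately have r1: "effects dequeue_agent (r, m) = (r1, m)"
        using R by (simp add: fun_eq_iff)
      have "bfs i ma mo (members \<circ> cl) (arr 4 m) (queue m (r1 15)) (r1 14) (r1 16)
          (insert (r 16) F) {} d"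
        using bfs_next all less by (simp add: r1_def j_def)
      moreover have "n - r 14 = Suc (n - Suc (r 14))" using less tail by simp
      then have "(n - r 14) * (1 + \<gamma>) = (n - Suc (r 14)) * (1 + \<gamma>) + 1 + \<gamma>"
        by simp
      then have "25 * ((n - r1 14) * (1 + \<gamma>) + (r1 18 - r1 17) + 1) + 2 + R + 25 \<le> k"
        using k \<open>class_address (cl j)\<close> by (simp add: r1_def class_address_def)
      moreover have "fixed_regs r1" using R by (simp add: fixed_regs_def r1_def)
      moreover have "{a<..<Suc a} = {}" for a by auto
      ultimately have "?I r1 m (k - 14)"
        unfolding search_inv_def
        using arrs intact r0 vis loop by (auto simp: r1_def)
      then show "wp (Block dequeue_agent) ?I r m (k - 4 - 2)"
        using \<open>26 \<le> k\<close> by (intro wp_Block[OF r1]) simp_all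
    }
    {
      assume "\<not> r 14 < r 15"
      then have "r 14 = r 15" using head by simp
      moreover have "25 * ((n - r 14) * (1 + \<gamma>)) + 2 + R \<le> k - 7" using k by simp
      then have "\<exists>F S d. bfs i ma mo (members \<circ> cl) (arr 4 m) (queue m (r 15)) (r 14) (r 16) F S d \<and>
          members (cl (r 16)) \<subseteq> S \<and> 25 * ((n - r 14) * (1 + \<gamma>)) + 2 + R \<le> k - 7"
        using bfs all by blast
      moreover have "fixed_regs (r(19 := 0))" using R by (simp add: fixed_regs_def)
      ultimately have "?I (r(19 := 0)) m (k - 7)"
        unfolding search_inv_def
        using arrs intact r0 vis loop(1) by auto
      then show "wp (Block [Const 19 0]) ?I r m (k - 4 - 2)"
        using \<open>26 \<le> k\<close> by (intro wp_Block) simp_all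
    }
  qed
  have "wp (If_less 17 18 scan_code advance_code) ?I r m (k - 2)"
    using scan_code advance_code \<open>26 \<le> k\<close> by (intro wp_If_less) simp_all
  then show "2 \<le> k \<and> wp (If_less 17 18 scan_code advance_code) ?I r m (k - 2)"
    using \<open>26 \<le> k\<close> by simp
qed

text \<open>An iteration takes at most 14 steps and treats one agent of the path; these are
  distinct, so there are at most \<open>n\<close>. The other 3 credits pay for setting the flag and
  for leaving the loop.\<close>

lemma wp_augment:
  assumes regs: "fixed_regs r" and intact: "input_intact m"
    and path: "alternating_path i (arr 0 m) (arr 6 m) K D J B"
    and parent: "\<And>t. t < D \<Longrightarrow> arr 4 m (J (Suc t)) = J t"
    and agents: "\<And>t. t \<le> D \<Longrightarrow> J t < n"
    and start: "r 16 = J D" "r 21 = B D"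
    and k: "14 * n + 3 + R \<le> k"
    and post: "\<And>r' m' k'. fixed_regs r' \<Longrightarrow> input_intact m' \<Longrightarrow> r' 9 = r 9 \<Longrightarrow>
      augmentation i (arr 0 m) (arr 6 m) K D J B (arr 0 m') (arr 6 m') \<Longrightarrow>
      arr 1 m' = arr 1 m \<Longrightarrow> arr 2 m' = arr 2 m \<Longrightarrow> arr 3 m' = arr 3 m \<Longrightarrow> R \<le> k' \<Longrightarrow> Q r' m' k'"
  shows "wp augment_code Q r m k"
proof -
  interpret alternating_path i "arr 0 m" "arr 6 m" K D J B by (fact path)
  have "card (J ` {..D}) \<le> card {..<n}"
    using agents by (intro card_mono) auto
  then have D: "D < n" by (simp add: card_image inj)
  define Inv where "Inv r' m' k' \<longleftrightarrow>
    fixed_regs r' \<and> input_intact m' \<and> r' 9 = r 9 \<and> arr 1 m' = arr 1 m \<and> arr 2 m' = arr 2 m \<and>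
    arr 3 m' = arr 3 m \<and> arr 4 m' = arr 4 m \<and>
    ((\<exists>t\<le>D. r' 19 = 1 \<and> r' 16 = J t \<and> r' 21 = B t \<and> augmented_from (Suc t) (arr 0 m') (arr 6 m') \<and>
        14 * (t + 1) + 2 + R \<le> k') \<or>
      r' 19 = 0 \<and> augmented_from 0 (arr 0 m') (arr 6 m') \<and> 2 + R \<le> k')" for r' m' k'
  let ?update = "[Add 23 0 16, Load 22 23, Add 28 21 1, Store 23 28, Add 23 8 21, Add 28 16 1, Store 23 28]"
  let ?up = "[Sub 21 22 1, Add 23 6 16, Load 16 23]"
  have "wp (While_less 24 19 (Block ?update ;; If_less 24 22 (Block ?up) (Block [Const 19 0]))) Q
      (r(19 := 1)) m (k - 1)"
  proof (rule wp_While_less[where Inv = Inv])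
    have "14 * (D + 1) \<le> 14 * n" using D by simp
    then have "14 * (D + 1) + 2 + R \<le> k - 1" using k by linarith
    then show "Inv (r(19 := 1)) m (k - 1)"
      using regs intact start augmented_from_start by (auto simp: Inv_def fixed_regs_def)
  next
    fix r' m' k'
    assume inv: "Inv r' m' k'" and exit: "\<not> r' 24 < r' 19"
    then have "r' 19 = 0" "fixed_regs r'" by (auto simp: Inv_def fixed_regs_def)
    then have "augmented_from 0 (arr 0 m') (arr 6 m')" "2 + R \<le> k'"
      using inv unfolding Inv_def by auto
    then show "2 \<le> k' \<and> Q r' m' (k' - 2)"
      using inv augmentation_if_augmented_from_0 unfolding Inv_def by (intro conjI post) auto
  next
    fix r' m' k'
    assume inv: "Inv r' m' k'" and loop: "r' 24 < r' 19"
    then obtain t where t: "t \<le> D" "r' 19 = 1" "r' 16 = J t" "r' 21 = B t"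
      "augmented_from (Suc t) (arr 0 m') (arr 6 m')" and k': "14 * (t + 1) + 2 + R \<le> k'"
      unfolding Inv_def by auto
    have regs': "fixed_regs r'" "input_intact m'" "r' 9 = r 9"
      and arrs: "arr 1 m' = arr 1 m" "arr 2 m' = arr 2 m" "arr 3 m' = arr 3 m" "arr 4 m' = arr 4 m"
      using inv unfolding Inv_def by blast+
    note R = regs'(1)[unfolded fixed_regs_def]
    have "J t < n" using agents t(1) by simp
    define m1 where "m1 = m'(base 0 + J t := Suc (B t), base 6 + B t := Suc (J t))"
    have old: "arr 0 m' (J t) = arr 0 m (J t)"
      using augmented_from_unchanged t by simp
    define r1 where "r1 = r'(22 := arr 0 m (J t), 28 := Suc (J t), 23 := base 6 + B t)"
    have r1: "effects ?update (r', m') = (r1, m1)"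
      using R t \<open>J t < n\<close> old by (simp add: r1_def m1_def arr_read fun_eq_iff)
    have m1: "arr 0 m1 = (arr 0 m')(J t := Suc (B t))" "arr 6 m1 = (arr 6 m')(B t := Suc (J t))"
      "arr 1 m1 = arr 1 m" "arr 2 m1 = arr 2 m" "arr 3 m1 = arr 3 m" "arr 4 m1 = arr 4 m"
      "input_intact m1"
      using \<open>J t < n\<close> arrs regs'(2) by (simp_all add: m1_def arr_upd input_intact_upd)
    have aug: "augmented_from t (arr 0 m1) (arr 6 m1)"
      unfolding m1 using augmented_from_step t by simp
    have "wp (If_less 24 22 (Block ?up) (Block [Const 19 0])) Inv r1 m1 (k' - 9)"
    proof (rule wp_If_less)
      assume "r1 24 < r1 22"
      then have "0 < t" using R root by (cases t) (auto simp: r1_def)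
      then obtain s where s: "t = Suc s" using gr0_conv_Suc by blast
      then have "s < D" using t(1) by simp
      define r2 where "r2 = r1(21 := B s, 23 := base 4 + J t, 16 := J s)"
      have "effects ?up (r1, m1) = (r2, m1)"
        using R \<open>J t < n\<close> t linked[OF \<open>s < D\<close>] parent[OF \<open>s < D\<close>] s m1
        by (simp add: r1_def r2_def arr_read)
      moreover have "fixed_regs r2" using R by (simp add: fixed_regs_def r1_def r2_def)
      then have "Inv r2 m1 (k' - 14)"
        unfolding Inv_def using m1 aug \<open>s < D\<close> s k' regs'(3) t(2)
        by (intro conjI disjI1 exI[of _ s]) (simp_all add: r1_def r2_def)
      ultimately show "wp (Block ?up) Inv r1 m1 (k' - 9 - 2)"
        using k' by (intro wp_Block) simp_all
    next
      assume "\<not> r1 24 < r1 22"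
      then have "arr 0 m (J t) = 0" using R by (simp add: r1_def)
      then have "t = 0" using linked[of "t - 1"] t(1) by (cases t) auto
      have "fixed_regs (r1(19 := 0))" using R by (simp add: fixed_regs_def r1_def)
      then have "Inv (r1(19 := 0)) m1 (k' - 12)"
        unfolding Inv_def using m1 aug \<open>t = 0\<close> k' regs'(3) by (simp add: r1_def)
      then show "wp (Block [Const 19 0]) Inv r1 m1 (k' - 9 - 2)"
        using k' by (intro wp_Block) simp_all
    qed (use k' in simp)
    then show "2 \<le> k' \<and> wp (Block ?update ;; If_less 24 22 (Block ?up) (Block [Const 19 0])) Inv r' m' (k' - 2)"
      using k' by (intro conjI wp_Block_Seq[OF r1]) simp_all
  qed
  then show ?thesis
    unfolding augment_code_def using k by (intro wp_Block_Seq) simp_all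
qed

section \<open>Lists and classes in the input word\<close>

definition list_address :: "nat \<Rightarrow> nat" where
  "list_address i = 2 + n + length (concat (map agent_word (take i ls)))"

lemma length_order: "length \<sigma> = n"
  using order distinct_card[of \<sigma>] by (simp add: agent_order_def)

lemma order_mem: "i \<in> set \<sigma> \<longleftrightarrow> i < n"
  using order by (auto simp: agent_order_def)

lemma order_in_word: "occurs_at w 2 \<sigma>"
  using occurs_at_self[of w] unfolding word by (simp add: numeral_2_eq_2)

lemma agent_word_in_word:
  assumes "i < n"
  shows "occurs_at w (list_address i) (agent_word (ls ! i))"
proof -
  have "ls = take i ls @ ls ! i # drop (Suc i) ls"
    using assms length_ls by (simp add: id_take_nth_drop)
  then have "w = ([n, num_objects I] @ \<sigma> @ concat (map agent_word (take i ls))) @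
      agent_word (ls ! i) @ concat (map agent_word (drop (Suc i) ls))"
    unfolding word by (metis (no_types, lifting) append.assoc concat.simps(2) concat_append list.simps(9) map_append)
  then have "occurs_at w 0 (([n, num_objects I] @ \<sigma> @ concat (map agent_word (take i ls))) @
      agent_word (ls ! i) @ concat (map agent_word (drop (Suc i) ls)))"
    using occurs_at_self[of w] by simp
  then show ?thesis
    unfolding occurs_at_append by (simp add: list_address_def length_order)
qed

lemma class_word_members:
  assumes "occurs_at w x (class_word xs)"
  shows "members x = set xs" "w ! x = length xs" "x + length xs < length w"
proof -
  have hd: "x < length w" "w ! x = length xs" and tl: "occurs_at w (Suc x) xs"
    using assms by (simp_all add: class_word_def)
  have "y \<in> (\<lambda>t. Suc x + t) ` {..<length xs}" if "y \<in> {x<..x + length xs}" for y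
    using that by (intro image_eqI[of _ _ "y - Suc x"]) auto
  then have "{x<..x + length xs} = (\<lambda>t. Suc x + t) ` {..<length xs}"
    by auto
  then have "members x = (\<lambda>t. w ! (Suc x + t)) ` {..<length xs}"
    unfolding members_def hd(2) by (simp add: image_image)
  also have "\<dots> = (!) xs ` {..<length xs}"
    using tl by (intro image_cong) (auto simp: occurs_at_def)
  also have "\<dots> = set xs" by (auto simp: set_conv_nth)
  finally show "members x = set xs" .
  show "w ! x = length xs" by fact
  show "x + length xs < length w"
    using hd tl unfolding occurs_at_def by (cases xs rule: rev_cases) force+
qed

lemma class_nth:
  assumes "i < n" "l < length (ls ! i)"
  shows "indiff_class I i l = set (ls ! i ! l)" "indiff_class I i l \<noteq> {}"
    "set (ls ! i ! l) \<subseteq> {..<num_objects I}" "length (ls ! i ! l) \<le> \<gamma>"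
proof -
  have len: "length (pref I i) = length (ls ! i)" using classes[OF assms(1)] by (metis length_map)
  have nth: "pref I i ! l = set (ls ! i ! l)" using classes[OF assms(1)] assms(2) by (metis nth_map)
  show eq: "indiff_class I i l = set (ls ! i ! l)"
    using len nth assms(2) by (simp add: indiff_class_def)
  have mem: "set (ls ! i ! l) \<in> set (pref I i)" using nth len assms(2) nth_mem by metis
  then show "indiff_class I i l \<noteq> {}" "set (ls ! i ! l) \<subseteq> {..<num_objects I}"
    using ha assms(1) eq unfolding ha_instance_def by auto
  have "{card C | C i. i < n \<and> C \<in> set (pref I i)} = (\<Union>i<n. card ` set (pref I i))" by auto
  then have "finite {card C | C i. i < n \<and> C \<in> set (pref I i)}" by simp
  then have "card (set (ls ! i ! l)) \<le> \<gamma>"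
    unfolding max_class_size_def using mem assms(1) by (intro Max_ge) auto
  then show "length (ls ! i ! l) \<le> \<gamma>"
    using distinct_classes[OF assms(1)] assms(2) by (simp add: distinct_card)
qed

lemma class_beyond: "i < n \<Longrightarrow> length (ls ! i) \<le> l \<Longrightarrow> indiff_class I i l = {}"
  using classes[of i] by (metis indiff_class_def length_map linorder_not_le)

section \<open>Time budgets and the invariant of the main loop\<close>

definition class_cost :: "nat list list \<Rightarrow> nat" where
  "class_cost cs = (\<Sum>xs\<leftarrow>cs. 50 + 25 * length xs)"

text \<open>In \<open>class_cost\<close> a class pays 25 per object scanned from the agent itself,
  25 for the extra unit of \<open>search_inv\<close>, and 25 for entering and leaving the search and
  moving on. The term with \<open>\<gamma>\<close> pays for exploring other agents,
  \<open>14 * n\<close> for the one augmentation.\<close>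

definition agent_cost :: "nat \<Rightarrow> nat" where
  "agent_cost i = class_cost (ls ! i) + 25 * (n * (1 + \<gamma>)) + 14 * n + 50"

text \<open>The amortization: \<open>h\<close> agents have already been dequeued for the current
  agent, and since the queue survives a failed search, the exploration budget is granted once per
  agent and not once per class.\<close>

definition remaining_cost :: "nat list \<Rightarrow> nat \<Rightarrow> nat \<Rightarrow> nat" where
  "remaining_cost is l h = (case is of [] \<Rightarrow> 0 | i # is' \<Rightarrow>
     class_cost (drop l (ls ! i)) + 25 * ((n - h) * (1 + \<gamma>)) + 14 * n + 50 + (\<Sum>j\<leftarrow>is'. agent_cost j))"

lemma remaining_cost_start: "remaining_cost is 0 0 = (\<Sum>i\<leftarrow>is. agent_cost i)"
  by (simp add: remaining_cost_def agent_cost_def split: list.split)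

text \<open>Between two steps exactly the matched agents have edges. For other agents the entry of
  array 2 may be left over from a rejected class and carries no information.\<close>

definition graph_inv :: "edges \<Rightarrow> edges \<Rightarrow> (nat \<Rightarrow> nat) \<Rightarrow> bool" where
  "graph_inv E M m \<longleftrightarrow>
     input_intact m \<and> (\<forall>j<n. arr 1 m j = list_address j) \<and>
     (\<forall>j ob. arr 0 m j = Suc ob \<longleftrightarrow> arr 6 m ob = Suc j) \<and>
     (\<forall>j. arr 0 m j \<noteq> 0 \<longrightarrow> class_address (arr 2 m j)) \<and>
     (\<forall>j ob. arr 0 m j = Suc ob \<longrightarrow> ob \<in> members (arr 2 m j)) \<and>
     M = matching_edges (arr 0 m) \<and>
     E = admitted_edges {j. arr 0 m j \<noteq> 0} (members \<circ> arr 2 m)"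

definition agents_inv :: "nat list \<Rightarrow> (nat \<Rightarrow> nat) \<Rightarrow> (nat \<Rightarrow> nat) \<Rightarrow> bool" where
  "agents_inv is r m \<longleftrightarrow>
     fixed_regs r \<and> 2 \<le> r 9 \<and> r 9 \<le> n + 2 \<and> is = drop (r 9 - 2) \<sigma> \<and> (\<forall>j\<in>set is. arr 0 m j = 0)"

text \<open>The last clause is the legacy of the failed searches: the queue is closed under
  alternating steps. \<open>r 14 = r 15\<close> says that all of it has been explored.\<close>

definition current_inv :: "nat \<Rightarrow> nat \<Rightarrow> (nat \<Rightarrow> nat) \<Rightarrow> (nat \<Rightarrow> nat) \<Rightarrow> bool" where
  "current_inv i l r m \<longleftrightarrow>
     r 11 = i \<and> r 12 + l = length (ls ! i) \<and>
     occurs_at w (r 13) (concat (map class_word (drop l (ls ! i)))) \<and>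
     r 14 = r 15 \<and> distinct (queue m (r 15)) \<and>
     (\<forall>j. arr 3 m j \<le> r 9) \<and> (\<forall>j. arr 3 m j = r 9 \<longleftrightarrow> j \<in> set (queue m (r 15))) \<and>
     (\<forall>j\<in>set (queue m (r 15)). arr 0 m j \<noteq> 0 \<and>
        (\<forall>ob\<in>members (arr 2 m j). \<exists>j'\<in>set (queue m (r 15)). arr 6 m ob = Suc j'))"

text \<open>The 2 credits on top are for leaving the main loop.\<close>

definition loop_inv :: "sdmt_state \<Rightarrow> (nat \<Rightarrow> nat) \<Rightarrow> (nat \<Rightarrow> nat) \<Rightarrow> nat \<Rightarrow> bool" where
  "loop_inv st r m k \<longleftrightarrow> (case st of (E, M, is, l) \<Rightarrow>
     graph_inv E M m \<and> agents_inv is r m \<and> (is \<noteq> [] \<longrightarrow> current_inv (hd is) l r m) \<and>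
     remaining_cost is l (r 15) + 2 \<le> k)"

lemma agents_inv_Cons:
  assumes "agents_inv (i # is) r m"
  shows "r 9 < n + 2" "w ! r 9 = i" "r 9 < length w" "is = drop (Suc (r 9) - 2) \<sigma>"
    "i < n" "i \<notin> set is" "set is \<subseteq> {..<n}"
proof -
  have d: "i # is = drop (r 9 - 2) \<sigma>" and "2 \<le> r 9"
    using assms by (simp_all add: agents_inv_def)
  then have len: "r 9 - 2 < n" using length_order by (metis drop_all linorder_not_le list.distinct(1))
  then show "r 9 < n + 2" by simp
  have "i # is = \<sigma> ! (r 9 - 2) # drop (Suc (r 9 - 2)) \<sigma>"
    unfolding d using len length_order Cons_nth_drop_Suc[of "r 9 - 2" \<sigma>] by simp
  then have i: "i = \<sigma> ! (r 9 - 2)" "is = drop (Suc (r 9 - 2)) \<sigma>" by simp_all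
  have "Suc (r 9) - 2 = Suc (r 9 - 2)" using \<open>2 \<le> r 9\<close> by simp
  then show "is = drop (Suc (r 9) - 2) \<sigma>" using i(2) by (simp only:)
  show "w ! r 9 = i" "r 9 < length w"
    using order_in_word i(1) len length_order \<open>2 \<le> r 9\<close> unfolding occurs_at_def
    by (metis le_add_diff_inverse)+
  have "distinct (i # is)" unfolding d using order by (simp add: agent_order_def)
  then show "i \<notin> set is" by simp
  have "set (i # is) \<subseteq> set \<sigma>" unfolding d by (rule set_drop_subset)
  then show "i < n" "set is \<subseteq> {..<n}" using order_mem by auto
qed

text \<open>\<open>stale\<close> says that nobody counts as visited, in accordance with the emptied
  queue. At the start it holds because the stamps are 0 and register 9 is 2, later because register
  9 has just grown.\<close>

lemma wp_load:
  assumes graph: "graph_inv E M m" and agents: "agents_inv is r m"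
    and stale: "\<And>j. arr 3 m j < r 9"
    and k: "11 + (\<Sum>i\<leftarrow>is. agent_cost i) \<le> k"
  shows "wp load_code (loop_inv (E, M, is, 0)) r m k"
  unfolding load_code_def
proof (rule wp_If_less)
  note R = agents[unfolded agents_inv_def fixed_regs_def]
  assume "r 9 < r 10"
  then have "is \<noteq> []" using R length_order by auto
  then obtain i is' where "is": "is = i # is'" by (cases "is") auto
  note cons = agents_inv_Cons[OF agents[unfolded "is"]]
  have at: "occurs_at w (list_address i) (agent_word (ls ! i))"
    using agent_word_in_word cons by blast
  have m: "m (r 9) = i" "m (base 1 + i) = list_address i" "m (list_address i) = length (ls ! i)"
    using cons graph at by (simp_all add: graph_inv_def input_intact_def arr_read agent_word_def)
  define r1 where "r1 = r(11 := i, 23 := list_address i, 12 := length (ls ! i),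
    13 := Suc (list_address i), 14 := 0, 15 := 0)"
  have r1: "effects [Load 11 9, Add 23 3 11, Load 23 23, Load 12 23, Add 13 23 1, Const 14 0, Const 15 0]
      (r, m) = (r1, m)"
    using R m by (simp add: r1_def fun_eq_iff)
  have "queue m 0 = []" by (simp add: queue_def)
  moreover have "arr 3 m j \<noteq> r 9" for j using stale[of j] by simp
  ultimately have "current_inv i 0 r1 m"
    using at less_imp_le[OF stale] by (simp add: current_inv_def r1_def agent_word_def)
  moreover have "agents_inv is r1 m"
    using agents by (simp add: agents_inv_def fixed_regs_def r1_def)
  moreover have "remaining_cost is 0 (r1 15) + 2 \<le> k - 9"
    using k remaining_cost_start[of "is"] by (simp add: r1_def)
  ultimately have "loop_inv (E, M, is, 0) r1 m (k - 9)"
    using graph by (simp add: loop_inv_def "is")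
  then show "wp (Block [Load 11 9, Add 23 3 11, Load 23 23, Load 12 23, Add 13 23 1, Const 14 0, Const 15 0])
      (loop_inv (E, M, is, 0)) r m (k - 2)"
    using k by (intro wp_Block[OF r1]) simp_all
next
  note R = agents[unfolded agents_inv_def fixed_regs_def]
  assume "\<not> r 9 < r 10"
  then have "is = []" using R length_order by auto
  then have "loop_inv (E, M, is, 0) r m (k - 2)"
    using graph agents k by (simp add: loop_inv_def remaining_cost_def)
  then show "wp (Block []) (loop_inv (E, M, is, 0)) r m (k - 2)"
    by (intro wp_Block) simp_all
qed (use k in simp)

lemma agents_inv_advance:
  assumes "agents_inv (i # is) r m" "fixed_regs r'" "r' 9 = Suc (r 9)"
    and "\<And>j. j \<in> set is \<Longrightarrow> arr 0 m' j = 0"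
  shows "agents_inv is r' m'"
  using assms agents_inv_Cons(1,4)[OF assms(1)] by (simp add: agents_inv_def)

lemma wp_next_agent:
  assumes graph: "graph_inv E M m" and agents: "agents_inv (i # is) r0 m0"
    and regs: "fixed_regs r" "r 9 = r0 9" and unmatched: "\<And>j. j \<in> set is \<Longrightarrow> arr 0 m j = 0"
    and stamps: "\<And>j. arr 3 m j \<le> r0 9"
    and k: "12 + (\<Sum>i\<leftarrow>is. agent_cost i) \<le> k"
  shows "wp (Block [Add 9 9 1] ;; load_code) (loop_inv (E, M, is, 0)) r m k"
proof -
  note R = regs[unfolded fixed_regs_def]
  define r1 where "r1 = r(9 := Suc (r0 9))"
  have r1: "effects [Add 9 9 1] (r, m) = (r1, m)" using R by (simp add: r1_def)
  have "fixed_regs r1" using R by (simp add: r1_def fixed_regs_def)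
  then have "agents_inv is r1 m"
    using agents unmatched by (intro agents_inv_advance[OF agents]) (simp_all add: r1_def)
  moreover have "arr 3 m j < r1 9" for j
    using stamps[of j] by (simp add: r1_def)
  ultimately have "wp load_code (loop_inv (E, M, is, 0)) r1 m (k - 1)"
    using k by (intro wp_load graph) simp_all
  then show ?thesis using k by (intro wp_Block_Seq[OF r1]) simp_all
qed

abbreviation step_post :: "sdmt_state \<Rightarrow> (nat \<Rightarrow> nat) \<Rightarrow> (nat \<Rightarrow> nat) \<Rightarrow> nat \<Rightarrow> bool" where
  "step_post st r m k \<equiv> \<exists>st'. sdmt1_step I (bfs_selection I) st st' \<and> loop_inv st' r m k"

lemma wp_step:
  assumes inv: "loop_inv (E, M, i # is, l) r m k"
  shows "2 \<le> k \<and> wp step_code (step_post (E, M, i # is, l)) r m (k - 2)"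
proof
  show "2 \<le> k" using inv by (simp add: loop_inv_def)
  have graph: "graph_inv E M m" and agents: "agents_inv (i # is) r m" and cur: "current_inv i l r m"
    and k: "remaining_cost (i # is) l (r 15) + 2 \<le> k"
    using inv by (simp_all add: loop_inv_def)
  note cons = agents_inv_Cons[OF agents]
  have regs: "fixed_regs r" and unmatched: "arr 0 m i = 0" "\<And>j. j \<in> set is \<Longrightarrow> arr 0 m j = 0"
    using agents by (simp_all add: agents_inv_def)
  note R = regs[unfolded fixed_regs_def]
  have cost: "class_cost (drop l (ls ! i)) + 25 * ((n - r 15) * (1 + \<gamma>)) + 14 * n + 52 +
      (\<Sum>j\<leftarrow>is. agent_cost j) \<le> k"
    using k by (simp add: remaining_cost_def)
  show "wp step_code (step_post (E, M, i # is, l)) r m (k - 2)"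
    unfolding step_code_def
  proof (rule wp_If_less)
    show "2 \<le> k - 2" using cost by simp
  next
    assume "\<not> r 24 < r 12"
    then have "length (ls ! i) \<le> l" using R cur by (simp add: current_inv_def)
    then have step: "sdmt1_step I (bfs_selection I) (E, M, i # is, l) (E, M, is, 0)"
      using class_beyond cons(5) by (intro sdmt1_step.exhausted) simp
    have "wp (Block [Add 9 9 1] ;; load_code) (loop_inv (E, M, is, 0)) r m (k - 2 - 2)"
      using graph agents regs unmatched cur cost
      by (intro wp_next_agent[of E M m i "is" r m]) (simp_all add: current_inv_def)
    then show "wp (Block [Add 9 9 1] ;; load_code) (step_post (E, M, i # is, l)) r m (k - 2 - 2)"
      by (rule wp_mono) (use step in blast, simp)
  next
    assume "r 24 < r 12"
    then have l: "l < length (ls ! i)" using R cur by (simp add: current_inv_def)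
    define xs where "xs = ls ! i ! l"
    note cls = class_nth[OF cons(5) l, folded xs_def]
    have drop: "drop l (ls ! i) = xs # drop (Suc l) (ls ! i)"
      using l by (simp add: xs_def Cons_nth_drop_Suc)
    have at: "occurs_at w (r 13) (class_word xs)"
      "occurs_at w (r 13 + w ! r 13 + 1) (concat (map class_word (drop (Suc l) (ls ! i))))"
      using cur drop by (simp_all add: current_inv_def class_word_def)
    note address = class_word_members[OF at(1)]
    have valid: "class_address (r 13)"
      using address cls by (simp add: class_address_def)
    define m1 where "m1 = m(base 2 + i := r 13)"
    have m1: "arr 0 m1 = arr 0 m" "arr 1 m1 = arr 1 m" "arr 2 m1 = (arr 2 m)(i := r 13)"
      "arr 3 m1 = arr 3 m" "arr 4 m1 = arr 4 m" "arr 6 m1 = arr 6 m"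
      "queue m1 (r 15) = queue m (r 15)" "input_intact m1"
      using graph cons(5) by (simp_all add: m1_def arr_upd queue_upd input_intact_upd graph_inv_def)
    define cl where "cl = arr 2 m1"
    have cl: "cl i = r 13" "\<And>j. j \<noteq> i \<Longrightarrow> cl j = arr 2 m j"
      using m1 by (simp_all add: cl_def)
    let ?A = "{j. arr 0 m j \<noteq> 0}"
    have notin: "i \<notin> ?A" using unmatched by simp
    \<comment> \<open>The address of the new class is written into the entry of \<open>i\<close>.
      This leaves \<open>E\<close> alone because \<open>i\<close> is still unmatched.\<close>
    have E: "E = admitted_edges ?A (members \<circ> cl)"
    proof -
      have "E = admitted_edges ?A (members \<circ> arr 2 m)" using graph by (simp add: graph_inv_def)
      also have "\<dots> = admitted_edges ?A (members \<circ> cl)"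
        unfolding admitted_edges_def using cl(2) notin by (intro Collect_cong) (metis comp_apply)
      finally show ?thesis .
    qed
    have class_edges: "class_edges I i l = {{Agent i, Obj ob} | ob. ob \<in> members (cl i)}"
      using address cls cl by (simp add: class_edges_def)
    have E': "E \<union> class_edges I i l = admitted_edges (insert i ?A) (members \<circ> cl)"
      unfolding E class_edges admitted_edges_def by auto
    have remove: "(E \<union> class_edges I i l) - class_edges I i l = E"
      unfolding E class_edges admitted_edges_def using notin by auto
    have M: "M = matching_edges (arr 0 m)" using graph by (simp add: graph_inv_def)
    have inverse: "arr 0 m j = Suc ob \<longleftrightarrow> arr 6 m ob = Suc j" for j ob
      using graph by (simp add: graph_inv_def)
    have matched: "ob \<in> (members \<circ> cl) j" if "arr 0 m j = Suc ob" for j ob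
      using that graph cl(2)[of j] unmatched by (cases "j = i") (simp_all add: graph_inv_def)
    have cl_valid: "class_address (cl j)" if "j = i \<or> arr 0 m j \<noteq> 0" for j
      using that valid graph cl by (cases "j = i") (simp_all add: graph_inv_def)
    let ?Q = "queue m (r 15)"
    have start: "bfs i (arr 0 m) (arr 6 m) (members \<circ> cl) (arr 4 m1) (queue m1 (r 15)) (length ?Q) i
        (set ?Q) {} (\<lambda>_. 0)"
      unfolding m1(7)
    proof (rule bfs_start)
      show "\<exists>j'\<in>set ?Q. arr 6 m ob = Suc j'" if "j \<in> set ?Q" "ob \<in> (members \<circ> cl) j" for j ob
      proof -
        have "arr 0 m j \<noteq> 0" using that(1) cur by (simp add: current_inv_def)
        then have "j \<noteq> i" using unmatched by auto
        then show ?thesis using that cur cl(2) by (simp add: current_inv_def)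
      qed
    qed (use inverse unmatched cur in \<open>auto simp: current_inv_def\<close>)
    let ?enter = "[Add 23 4 11, Store 23 13, Add 16 11 24, Load 18 13, Add 17 13 1, Add 18 18 17,
      Const 19 1, Const 20 0]"
    define r1 where "r1 = r(23 := base 2 + i, 16 := i, 18 := w ! r 13 + Suc (r 13), 17 := Suc (r 13),
      19 := 1, 20 := 0)"
    have "m1 (r 13) = w ! r 13" using m1(8) address by (simp add: input_intact_def)
    then have r1: "effects ?enter (r, m) = (r1, m1)"
      using R cur by (simp add: r1_def m1_def current_inv_def fun_eq_iff)
    \<comment> \<open>The budget that must survive the search, enough for an augmentation and
      loading the next agent; with the unspent exploration credits it also covers a rejection. Its
      63 is 52 from \<open>cost\<close> plus 50 from the class, less 12 for entering, 25 for the
      extra unit of \<open>search_inv\<close> and 2 for leaving the search loop.\<close>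
    define rest where "rest = class_cost (drop (Suc l) (ls ! i)) + 14 * n + 63 + (\<Sum>j\<leftarrow>is. agent_cost j)"
    have k1: "25 * ((n - r 15) * (1 + \<gamma>) + length xs + 1) + 2 + rest \<le> k - 12"
      using cost drop by (simp add: class_cost_def rest_def)
    have empty: "{a<..<Suc a} = {}" for a :: nat by auto
    let ?S = "search_inv i (arr 0 m) (arr 6 m) cl (arr 1 m) r rest"
    have "fixed_regs r1" using R by (simp add: fixed_regs_def r1_def)
    then have "?S r1 m1 (k - 12)"
      unfolding search_inv_def
      using m1 start cur k1 address cl
      by (auto simp: r1_def cl_def current_inv_def empty intro!: exI[of _ "set ?Q"])
    then have search: "wp search_code (wp (If_less 24 20
          (augment_code ;; Block [Add 9 9 1] ;; load_code)
          (Block [Load 23 13, Add 13 13 23, Add 13 13 1, Sub 12 12 1]))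
        (step_post (E, M, i # is, l))) r1 m1 (k - 12)"
    proof (rule wp_search)
      show "i < n" by (fact cons(5))
      show "class_address (cl j)" if "j = i \<or> arr 0 m j \<noteq> 0" for j
        using cl_valid that .
      fix r2 m2 k2
      assume inv2: "?S r2 m2 (k2 + 2)" and stop: "r2 19 = 0"
      then obtain F S d where
        bfs: "bfs i (arr 0 m) (arr 6 m) (members \<circ> cl) (arr 4 m2) (queue m2 (r2 15)) (r2 14) (r2 16) F S d"
        and result: "r2 20 = 0 \<and> members (cl (r2 16)) \<subseteq> S \<and> r2 14 = r2 15 \<and>
            25 * ((n - r2 14) * (1 + \<gamma>)) + rest \<le> k2 \<or>
          r2 20 = 1 \<and> r2 21 \<in> members (cl (r2 16)) \<and> arr 6 m (r2 21) = 0 \<and> rest \<le> k2"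
        unfolding search_inv_def by auto
      have regs2: "fixed_regs r2" "input_intact m2" "r2 9 = r 9" "r2 11 = r 11" "r2 12 = r 12" "r2 13 = r 13"
        and arrs2: "arr 0 m2 = arr 0 m" "arr 1 m2 = arr 1 m" "arr 2 m2 = cl" "arr 6 m2 = arr 6 m"
        and stamps2: "\<And>j. arr 3 m2 j \<le> r2 9" "\<And>j. arr 3 m2 j = r2 9 \<longleftrightarrow> j \<in> set (queue m2 (r2 15))"
        using inv2 unfolding search_inv_def by blast+
      note R2 = regs2(1)[unfolded fixed_regs_def]
      interpret bfs i "arr 0 m" "arr 6 m" "members \<circ> cl" "arr 4 m2" "queue m2 (r2 15)" "r2 14" "r2 16" F S d
        by (fact bfs)
      have "2 \<le> k2" "rest \<le> k2" using result by (auto simp: rest_def)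
      show "wp (If_less 24 20 (augment_code ;; Block [Add 9 9 1] ;; load_code)
          (Block [Load 23 13, Add 13 13 23, Add 13 13 1, Sub 12 12 1])) (step_post (E, M, i # is, l)) r2 m2 k2"
      proof (rule wp_If_less)
        show "2 \<le> k2" by fact
      next
        assume "r2 24 < r2 20"
        then have found: "r2 21 \<in> members (cl (r2 16))" "arr 6 m (r2 21) = 0"
          using result R2 by auto
        define B where "B t = (if t = d (r2 16) then r2 21 else arr 0 m (ancestor (Suc t)) - 1)" for t
        have path: "alternating_path i (arr 0 m) (arr 6 m) (members \<circ> cl) (d (r2 16)) ancestor B"
          unfolding B_def using bfs_found[of "r2 21"] found matched by simp
        interpret path: alternating_path i "arr 0 m" "arr 6 m" "members \<circ> cl" "d (r2 16)" ancestor B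
          by (fact path)
        have mem: "ancestor t \<in> insert i ?A" if "t \<le> d (r2 16)" for t
          using ancestor_mem[OF that] queue_matched by blast
        have in_range: "j < n" if "j \<in> insert i ?A" for j
          using that cons(5) arr_positive by blast
        have "r2 16 \<in> insert i ?A" using mem[of "d (r2 16)"] ancestor_top by simp
        then have "class_address (cl (r2 16))" using cl_valid by blast
        then have "r2 21 < num_objects I" using found(1) by (auto simp: class_address_def)
        then have aug: "augmenting_path I (E \<union> class_edges I i l) M i path.path"
          unfolding E' M by (intro path.augmenting_path_path mem) (simp add: B_def)
        \<comment> \<open>The path found has \<open>2 * d (r2 16) + 2\<close> vertices and thus
          attains the lower bound.\<close>
        have "bfs_selection I (E \<union> class_edges I i l) M i path.path"
          unfolding bfs_selection_def
        proof (intro allI impI)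
          fix q assume "augmenting_path I (E \<union> class_edges I i l) M i q"
          then have "2 * d (r2 16) + 2 \<le> length q"
            unfolding E' M by (rule augmenting_path_length_ge_depth)
          then show "length path.path \<le> length q" by simp
        qed
        with aug have step: "sdmt1_step I (bfs_selection I) (E, M, i # is, l)
            (E \<union> class_edges I i l, sym_diff M (path_edges path.path), is, 0)"
          by (intro sdmt1_step.augment) (use cls in auto)
        show "wp (augment_code ;; Block [Add 9 9 1] ;; load_code) (step_post (E, M, i # is, l)) r2 m2 (k2 - 2)"
        proof (rule wp_Seq, rule wp_augment)
          show "fixed_regs r2" "input_intact m2" by fact+
          show "alternating_path i (arr 0 m2) (arr 6 m2) (members \<circ> cl) (d (r2 16)) ancestor B"
            using path arrs2 by simp
          show "arr 4 m2 (ancestor (Suc t)) = ancestor t" if "t < d (r2 16)" for t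
            using ancestor_Suc[OF that] by simp
          show "ancestor t < n" if "t \<le> d (r2 16)" for t
            using mem[OF that] in_range by blast
          show "r2 16 = ancestor (d (r2 16))" using ancestor_top by simp
          show "r2 21 = B (d (r2 16))" by (simp add: B_def)
          show "14 * n + 3 + (12 + (\<Sum>j\<leftarrow>is. agent_cost j)) \<le> k2 - 2"
            using \<open>rest \<le> k2\<close> by (simp add: rest_def)
        next
          fix r3 m3 k3
          assume regs3: "fixed_regs r3" "input_intact m3" "r3 9 = r2 9"
            and arrs3: "arr 1 m3 = arr 1 m2" "arr 2 m3 = arr 2 m2" "arr 3 m3 = arr 3 m2"
            and k3: "12 + (\<Sum>j\<leftarrow>is. agent_cost j) \<le> k3"
            and "augmentation i (arr 0 m2) (arr 6 m2) (members \<circ> cl) (d (r2 16)) ancestor B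
              (arr 0 m3) (arr 6 m3)"
          then interpret aug: augmentation i "arr 0 m" "arr 6 m" "members \<circ> cl" "d (r2 16)" ancestor B
            "arr 0 m3" "arr 6 m3"
            using arrs2 by simp
          have "graph_inv (E \<union> class_edges I i l) (sym_diff M (path_edges path.path)) m3"
            unfolding graph_inv_def
          proof (intro conjI allI impI)
            show "arr 1 m3 j = list_address j" if "j < n" for j
              using that arrs3 arrs2 graph by (simp add: graph_inv_def)
            show "class_address (arr 2 m3 j)" if "arr 0 m3 j \<noteq> 0" for j
            proof -
              have "j = i \<or> arr 0 m j \<noteq> 0" using aug.matched_agents' that by blast
              then show ?thesis using cl_valid arrs3 arrs2 by simp
            qed
            show "ob \<in> members (arr 2 m3 j)" if "arr 0 m3 j = Suc ob" for j ob
              using aug.admitted'[OF that] arrs3 arrs2 by simp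
            show "sym_diff M (path_edges path.path) = matching_edges (arr 0 m3)"
              using aug.matching_edges' M by simp
            show "E \<union> class_edges I i l = admitted_edges {j. arr 0 m3 j \<noteq> 0} (members \<circ> arr 2 m3)"
              unfolding aug.matched_agents' E' using arrs3 arrs2 by simp
          qed (use regs3 aug.inverse' in auto)
          then have "wp (Block [Add 9 9 1] ;; load_code)
              (loop_inv (E \<union> class_edges I i l, sym_diff M (path_edges path.path), is, 0)) r3 m3 k3"
          proof (rule wp_next_agent[OF _ agents])
            show "arr 0 m3 j = 0" if "j \<in> set is" for j
            proof -
              have "j \<noteq> i" "arr 0 m j = 0" using that cons(6) unmatched(2) by auto
              then show ?thesis using aug.matched_agents' by blast
            qed
            show "arr 3 m3 j \<le> r 9" for j
              using stamps2(1)[of j] arrs3 regs2 by simp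
          qed (use regs3 regs2 k3 in simp_all)
          then show "wp (Block [Add 9 9 1] ;; load_code) (step_post (E, M, i # is, l)) r3 m3 k3"
            by (rule wp_mono) (use step in blast, simp)
        qed
      next
        assume "\<not> r2 24 < r2 20"
        then have fail: "members (cl (r2 16)) \<subseteq> S" "r2 14 = r2 15"
          "25 * ((n - r2 14) * (1 + \<gamma>)) + rest \<le> k2"
          using result R2 by auto
        have "\<not> augmenting_path I (E \<union> class_edges I i l) M i p" for p
          unfolding E' M using fail by (intro bfs_fail) simp_all
        then have step: "sdmt1_step I (bfs_selection I) (E, M, i # is, l) (E, M, i # is, Suc l)"
          using sdmt1_step.reject[of I i l "E \<union> class_edges I i l" E M "bfs_selection I" "is"]
            cls(2) remove by simp
        define r3 where "r3 = r2(23 := w ! r 13, 13 := r 13 + w ! r 13 + 1, 12 := r 12 - 1)"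
        have "m2 (r 13) = w ! r 13" using regs2 address by (simp add: input_intact_def)
        then have r3: "effects [Load 23 13, Add 13 13 23, Add 13 13 1, Sub 12 12 1] (r2, m2) = (r3, m2)"
          using R2 regs2 by (simp add: r3_def)
        have "graph_inv E M m2"
          unfolding graph_inv_def
        proof (intro conjI allI impI)
          show "class_address (arr 2 m2 j)" if "arr 0 m2 j \<noteq> 0" for j
            using that cl_valid arrs2 by simp
          show "ob \<in> members (arr 2 m2 j)" if "arr 0 m2 j = Suc ob" for j ob
            using that matched arrs2 by simp
          show "E = admitted_edges {j. arr 0 m2 j \<noteq> 0} (members \<circ> arr 2 m2)"
            using E arrs2 by simp
        qed (use regs2 arrs2 graph in \<open>simp_all add: graph_inv_def\<close>)
        moreover have "agents_inv (i # is) r3 m2"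
        proof -
          have "fixed_regs r3" using R2 by (simp add: r3_def fixed_regs_def)
          have "r3 9 = r 9" using regs2 by (simp add: r3_def)
          then show ?thesis
            using agents \<open>fixed_regs r3\<close> unfolding agents_inv_def arrs2(1) by metis
        qed
        moreover have "current_inv i (Suc l) r3 m2"
          unfolding current_inv_def
        proof (intro conjI ballI)
          show "r3 12 + Suc l = length (ls ! i)"
            using cur l by (simp add: current_inv_def r3_def)
          show "arr 0 m2 j \<noteq> 0" if "j \<in> set (queue m2 (r3 15))" for j
            using that queue_matched arrs2 by (simp add: r3_def)
          show "\<exists>j'\<in>set (queue m2 (r3 15)). arr 6 m2 ob = Suc j'"
            if "j \<in> set (queue m2 (r3 15))" "ob \<in> members (arr 2 m2 j)" for j ob
            using that queue_closed[of j ob] fail arrs2 by (simp add: r3_def)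
        qed (use regs2 cur at fail distinct stamps2 in \<open>simp_all add: r3_def current_inv_def\<close>)
        moreover have "remaining_cost (i # is) (Suc l) (r3 15) + 2 \<le> k2 - 6"
          using fail by (simp add: remaining_cost_def rest_def r3_def)
        ultimately have "loop_inv (E, M, i # is, Suc l) r3 m2 (k2 - 6)"
          by (simp add: loop_inv_def)
        then show "wp (Block [Load 23 13, Add 13 13 23, Add 13 13 1, Sub 12 12 1])
            (step_post (E, M, i # is, l)) r2 m2 (k2 - 2)"
          using \<open>rest \<le> k2\<close> step by (intro wp_Block[OF r3]) (auto simp: rest_def)
      qed
    qed
    have eq: "k - 2 - 2 - length ?enter = k - 12" by simp
    show "wp (Block ?enter ;; search_code ;;
        If_less 24 20 (augment_code ;; Block [Add 9 9 1] ;; load_code)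
          (Block [Load 23 13, Add 13 13 23, Add 13 13 1, Sub 12 12 1]))
        (step_post (E, M, i # is, l)) r m (k - 2 - 2)"
      by (rule wp_Block_Seq[OF r1], simp, use cost in simp, unfold eq, rule wp_Seq, rule search)
  qed
qed

section \<open>Reading the input and setting up the arrays\<close>

lemma wp_skip:
  assumes regs: "r 24 = 0" "r 1 = 1" and intact: "input_intact m"
    and at: "occurs_at w (r 25) (agent_word cs)"
    and k: "4 + 6 * length cs + R \<le> k"
    and post: "\<And>r' k'. (\<And>x. x \<notin> {23, 25, 27} \<Longrightarrow> r' x = r x) \<Longrightarrow>
      r' 25 = r 25 + length (agent_word cs) \<Longrightarrow> R \<le> k' \<Longrightarrow> Q r' m k'"
  shows "wp skip_code Q r m k"
proof -
  define Inv where "Inv r' m' k' \<longleftrightarrow> m' = m \<and> (\<forall>x. x \<notin> {23, 25, 27} \<longrightarrow> r' x = r x) \<and>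
    (\<exists>ds. r' 27 = length ds \<and> occurs_at w (r' 25) (concat (map class_word ds)) \<and>
       r' 25 + length (concat (map class_word ds)) = r 25 + length (agent_word cs) \<and>
       6 * length ds + 2 + R \<le> k')" for r' m' k'
  define r1 where "r1 = r(27 := length cs, 25 := Suc (r 25))"
  have r1: "effects [Load 27 25, Add 25 25 1] (r, m) = (r1, m)"
    using at intact regs by (simp add: r1_def agent_word_def input_intact_def)
  have "wp (While_less 24 27 (Block [Load 23 25, Add 25 25 23, Add 25 25 1, Sub 27 27 1])) Q r1 m (k - 2)"
  proof (rule wp_While_less[where Inv = Inv])
    show "Inv r1 m (k - 2)"
      unfolding Inv_def using at k
      by (intro conjI exI[of _ cs]) (simp_all add: r1_def agent_word_def)
  next
    fix r' m' k'
    assume inv: "Inv r' m' k'" and exit: "\<not> r' 24 < r' 27"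
    then have "r' 27 = 0" using regs by (simp add: Inv_def)
    then have "2 + R \<le> k'" "r' 25 = r 25 + length (agent_word cs)" "m' = m"
      using inv by (auto simp: Inv_def)
    moreover have "\<And>x. x \<notin> {23, 25, 27} \<Longrightarrow> r' x = r x"
      using inv unfolding Inv_def by blast
    ultimately show "2 \<le> k' \<and> Q r' m' (k' - 2)" using post by simp
  next
    fix r' m' k'
    assume inv: "Inv r' m' k'" and loop: "r' 24 < r' 27"
    then obtain ds where ds: "r' 27 = length ds" "occurs_at w (r' 25) (concat (map class_word ds))"
      "r' 25 + length (concat (map class_word ds)) = r 25 + length (agent_word cs)"
      "6 * length ds + 2 + R \<le> k'" and m': "m' = m" and frame: "\<forall>x. x \<notin> {23, 25, 27} \<longrightarrow> r' x = r x"
      unfolding Inv_def by blast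
    then obtain xs ds' where xs: "ds = xs # ds'" using loop by (cases ds) auto
    have "r' 1 = 1" "r' 24 = 0" using frame regs by simp_all
    define r2 where "r2 = r'(23 := length xs, 25 := Suc (r' 25 + length xs), 27 := length ds')"
    have r2: "effects [Load 23 25, Add 25 25 23, Add 25 25 1, Sub 27 27 1] (r', m') = (r2, m')"
      using ds xs intact m' \<open>r' 1 = 1\<close> by (simp add: r2_def class_word_def input_intact_def)
    have "Inv r2 m' (k' - 6)"
      unfolding Inv_def using ds xs frame m'
      by (intro conjI exI[of _ ds']) (simp_all add: r2_def class_word_def)
    then show "2 \<le> k' \<and> wp (Block [Load 23 25, Add 25 25 23, Add 25 25 1, Sub 27 27 1]) Inv r' m' (k' - 2)"
      using ds xs by (intro conjI wp_Block[OF r2]) simp_all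
  qed
  then show ?thesis
    unfolding skip_code_def using k by (intro wp_Block_Seq[OF r1]) (simp_all add: numeral_2_eq_2)
qed

text \<open>The 9 consists of 2 for the loop, 2 for storing the address, 4 for
  \<open>skip_code\<close> and 1 for the counter; the first pass stores nothing and wastes 2. A
  class is skipped by adding its length, so classes are charged and not objects.\<close>

definition scan_cost :: "nat \<Rightarrow> nat" where
  "scan_cost j = (\<Sum>cs\<leftarrow>drop j ls. 9 + 6 * length cs)"

lemma scan_cost_step: "j < n \<Longrightarrow> scan_cost j = 9 + 6 * length (ls ! j) + scan_cost (Suc j)"
  using length_ls by (simp add: scan_cost_def flip: Cons_nth_drop_Suc)

lemma list_address_0: "list_address 0 = n + 2"
  by (simp add: list_address_def)

lemma list_address_Suc: "j < n \<Longrightarrow> list_address (Suc j) = list_address j + length (agent_word (ls ! j))"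
  using length_ls by (simp add: list_address_def take_Suc_conv_app_nth)

lemma list_address_n: "list_address n = length w"
  by (simp add: list_address_def length_ls length_order word)

lemma wp_scan_step:
  assumes regs: "r 24 = 0" "r 1 = 1" and intact: "input_intact m" and j: "r 26 = j" "j < n"
    and at: "r 25 = list_address j" and k: "scan_cost j + R \<le> k + 4"
    and post: "\<And>r' k'. (\<And>x. x \<notin> {23, 25, 26, 27} \<Longrightarrow> r' x = r x) \<Longrightarrow> r' 26 = Suc j \<Longrightarrow>
      r' 25 = list_address (Suc j) \<Longrightarrow> scan_cost (Suc j) + R \<le> k' \<Longrightarrow> Q r' m k'"
  shows "wp (skip_code ;; Block [Add 26 26 1]) Q r m k"
proof (rule wp_Seq, rule wp_skip)
  show "r 24 = 0" "r 1 = 1" "input_intact m" by fact+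
  show "occurs_at w (r 25) (agent_word (ls ! j))" using agent_word_in_word j at by simp
  show "4 + 6 * length (ls ! j) + (1 + scan_cost (Suc j) + R) \<le> k"
    using k scan_cost_step[OF j(2)] by simp
next
  fix r' k'
  assume frame: "\<And>x. x \<notin> {23, 25, 27} \<Longrightarrow> r' x = r x"
    and r': "r' 25 = r 25 + length (agent_word (ls ! j))" and k': "1 + scan_cost (Suc j) + R \<le> k'"
  have eff: "effects [Add 26 26 1] (r', m) = (r'(26 := Suc j), m)"
    using frame[of 26] frame[of 1] regs j by simp
  have "Q (r'(26 := Suc j)) m (k' - 1)"
    using frame r' k' at list_address_Suc[OF j(2)] by (intro post) simp_all
  then show "wp (Block [Add 26 26 1]) Q r' m k'"
    using k' by (intro wp_Block[OF eff]) simp_all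
qed

definition total_cost :: nat where
  "total_cost = 40 + 2 * scan_cost 0 + (\<Sum>i\<leftarrow>\<sigma>. agent_cost i)"

lemma wp_init:
  "wp init_code (loop_inv ({}, {}, \<sigma>, 0)) (\<lambda>_. 0) (\<lambda>a. if a < length w then w ! a else 0) total_cost"
proof -
  let ?m = "\<lambda>a. if a < length w then w ! a else 0"
  let ?Q = "loop_inv ({}, {}, \<sigma>, 0)"
  let ?rest = "12 + (\<Sum>i\<leftarrow>\<sigma>. agent_cost i)"
  have intact: "input_intact ?m" by (simp add: input_intact_def)
  have zero: "arr k ?m = (\<lambda>_. 0)" for k by (auto simp: arr_def base_def fun_eq_iff)
  define r1 :: "nat \<Rightarrow> nat" where "r1 = (\<lambda>_. 0)(1 := 1, 2 := n, 10 := n + 2, 26 := 0, 25 := n + 2)"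
  have r1: "effects [Const 1 1, Load 2 24, Const 10 2, Add 10 10 2, Const 26 0, Add 25 10 24] (\<lambda>_. 0, ?m) = (r1, ?m)"
    by (simp add: r1_def word)
  \<comment> \<open>The summands pay in turn for leaving the first loop, computing the base
    addresses, the second pass, leaving it, initializing register 9, and all that follows.\<close>
  define Inv1 where "Inv1 r m k \<longleftrightarrow> m = ?m \<and> r 1 = 1 \<and> r 2 = n \<and> r 10 = n + 2 \<and> r 24 = 0 \<and> r 26 \<le> n \<and>
    r 25 = list_address (r 26) \<and> scan_cost (r 26) + (2 + 9 + scan_cost 0 + 2 + 1 + ?rest) \<le> k" for r m :: "nat \<Rightarrow> nat" and k
  define Inv2 where "Inv2 r m k \<longleftrightarrow> fixed_regs r \<and> input_intact m \<and> r 26 \<le> n \<and> r 25 = list_address (r 26) \<and>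
    (\<forall>j<r 26. arr 1 m j = list_address j) \<and> arr 0 m = (\<lambda>_. 0) \<and> arr 3 m = (\<lambda>_. 0) \<and> arr 6 m = (\<lambda>_. 0) \<and>
    scan_cost (r 26) + (2 + 1 + ?rest) \<le> k" for r m :: "nat \<Rightarrow> nat" and k
  let ?third = "Block [Const 9 2] ;; load_code"
  have third: "2 \<le> k \<and> wp ?third ?Q r m (k - 2)" if inv: "Inv2 r m k" and exit: "\<not> r 26 < r 2" for r m k
  proof -
    have R: "fixed_regs r" using inv by (simp add: Inv2_def)
    then have r26: "r 26 = n" using inv exit by (simp add: Inv2_def fixed_regs_def)
    have k: "2 + 1 + ?rest \<le> k" using inv by (simp add: Inv2_def)
    have "graph_inv {} {} m"
      using inv r26 by (simp add: graph_inv_def Inv2_def matching_edges_def admitted_edges_def)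
    moreover have "agents_inv \<sigma> (r(9 := 2)) m"
      using inv R by (simp add: agents_inv_def Inv2_def fixed_regs_def)
    moreover have "11 + (\<Sum>i\<leftarrow>\<sigma>. agent_cost i) \<le> k - 3" using k by simp
    ultimately have "wp load_code ?Q (r(9 := 2)) m (k - 3)"
      using inv by (intro wp_load) (simp_all add: Inv2_def)
    then show ?thesis using k by (intro conjI wp_Block_Seq) simp_all
  qed
  let ?second = "While_less 26 2 (Block [Add 23 3 26, Store 23 25] ;; skip_code ;; Block [Add 26 26 1]) ;; ?third"
  have second: "wp ?second ?Q r m k" if "Inv2 r m k" for r m k
  proof (rule wp_Seq, rule wp_While_less[where Inv = Inv2, OF that _ third])
    fix r m k
    assume inv: "Inv2 r m k" and loop: "r 26 < r 2"
    define j where "j = r 26"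
    have R: "fixed_regs r" using inv by (simp add: Inv2_def)
    note R' = this[unfolded fixed_regs_def]
    have j: "j < n" using loop R' by (simp add: j_def)
    define m' where "m' = m(base 1 + j := list_address j)"
    define r2 where "r2 = r(23 := base 1 + j)"
    have r2: "effects [Add 23 3 26, Store 23 25] (r, m) = (r2, m')"
      using R' inv by (simp add: r2_def m'_def j_def Inv2_def)
    have m': "input_intact m'" "arr 1 m' = (arr 1 m)(j := list_address j)"
      "arr 0 m' = (\<lambda>_. 0)" "arr 3 m' = (\<lambda>_. 0)" "arr 6 m' = (\<lambda>_. 0)"
      using inv j by (simp_all add: m'_def arr_upd input_intact_upd Inv2_def)
    have k: "scan_cost j + (2 + 1 + ?rest) \<le> k" using inv by (simp add: Inv2_def j_def)
    have "wp (skip_code ;; Block [Add 26 26 1]) Inv2 r2 m' (k - 4)"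
    proof (rule wp_scan_step[where j = j and R = "2 + 1 + ?rest"])
      show "scan_cost j + (2 + 1 + ?rest) \<le> k - 4 + 4" using k scan_cost_step[OF j] by simp
    next
      fix r' k'
      assume frame: "\<And>x. x \<notin> {23, 25, 26, 27} \<Longrightarrow> r' x = r2 x"
        and r': "r' 26 = Suc j" "r' 25 = list_address (Suc j)"
        and k': "scan_cost (Suc j) + (2 + 1 + ?rest) \<le> k'"
      have "fixed_regs r'" using R' frame by (simp add: fixed_regs_def r2_def)
      moreover have "arr 1 m' t = list_address t" if "t < Suc j" for t
        using that inv m' by (cases "t = j") (simp_all add: Inv2_def j_def)
      ultimately show "Inv2 r' m' k'" using r' m' k' j by (simp add: Inv2_def)
    qed (use R' m' j inv in \<open>simp_all add: r2_def j_def Inv2_def\<close>)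
    then show "2 \<le> k \<and> wp (Block [Add 23 3 26, Store 23 25] ;; skip_code ;; Block [Add 26 26 1]) Inv2 r m (k - 2)"
      using k scan_cost_step[OF j] by (intro conjI wp_Block_Seq[OF r2]) simp_all
  qed
  let ?bases = "[Add 0 25 24, Add 3 25 2, Add 4 3 2, Add 5 4 2, Add 6 5 2, Add 7 6 2, Add 8 7 2,
            Const 26 0, Add 25 10 24]"
  have first: "2 \<le> k \<and> wp (Block ?bases ;; ?second) ?Q r m (k - 2)"
    if inv: "Inv1 r m k" and exit: "\<not> r 26 < r 2" for r m k
  proof -
    have "r 26 = n" "r 25 = length w" using inv exit list_address_n by (auto simp: Inv1_def)
    define r2 where "r2 = r(0 := base 0, 3 := base 1, 4 := base 2, 5 := base 3, 6 := base 4, 7 := base 5,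
      8 := base 6, 26 := 0, 25 := n + 2)"
    have r2: "effects ?bases (r, m) = (r2, m)"
      using inv \<open>r 25 = length w\<close> by (simp add: r2_def Inv1_def base_def fun_eq_iff)
    have "fixed_regs r2" using inv by (simp add: fixed_regs_def r2_def Inv1_def)
    moreover have "scan_cost (r 26) + (2 + 9 + scan_cost 0 + 2 + 1 + ?rest) \<le> k"
      using inv by (simp only: Inv1_def)
    then have "scan_cost 0 + (2 + 1 + ?rest) \<le> k - 11" by linarith
    ultimately have "Inv2 r2 m (k - 11)"
      using inv intact zero list_address_0 by (simp add: Inv2_def Inv1_def r2_def)
    then have "wp ?second ?Q r2 m (k - 11)" by (rule second)
    moreover have "11 \<le> k" using inv by (simp add: Inv1_def)
    ultimately show ?thesis by (intro conjI wp_Block_Seq[OF r2]) simp_all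
  qed
  have "wp (While_less 26 2 (skip_code ;; Block [Add 26 26 1]) ;; Block ?bases ;; ?second) ?Q r1 ?m
      (total_cost - 6)"
  proof (rule wp_Seq, rule wp_While_less[where Inv = Inv1, OF _ _ first])
    show "Inv1 r1 ?m (total_cost - 6)"
      by (simp add: Inv1_def r1_def list_address_0 total_cost_def)
  next
    fix r m k
    assume inv: "Inv1 r m k" and loop: "r 26 < r 2"
    define j where "j = r 26"
    have j: "j < n" using loop inv by (simp add: j_def Inv1_def)
    let ?R = "2 + 9 + scan_cost 0 + 2 + 1 + ?rest"
    have k: "scan_cost j + ?R \<le> k" using inv by (simp add: Inv1_def j_def)
    have "wp (skip_code ;; Block [Add 26 26 1]) Inv1 r m (k - 2)"
    proof (rule wp_scan_step[where j = j and R = ?R])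
      show "scan_cost j + ?R \<le> k - 2 + 4" using k by simp
    next
      fix r' k'
      assume frame: "\<And>x. x \<notin> {23, 25, 26, 27} \<Longrightarrow> r' x = r x"
        and r': "r' 26 = Suc j" "r' 25 = list_address (Suc j)"
        and k': "scan_cost (Suc j) + ?R \<le> k'"
      show "Inv1 r' m k'" using frame r' k' j inv by (simp add: Inv1_def)
    qed (use j inv intact in \<open>simp_all add: j_def Inv1_def\<close>)
    then show "2 \<le> k \<and> wp (skip_code ;; Block [Add 26 26 1]) Inv1 r m (k - 2)"
      using k by simp
  qed
  then show ?thesis
    unfolding init_code_def by (intro wp_Block_Seq[OF r1]) (simp_all add: total_cost_def)
qed

section \<open>From the main loop to an execution of SDMT-1\<close>

lemma holds_matching_loop_inv:
  assumes "loop_inv st r m k"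
  shows "holds_matching I (config_at p r m) (fst (snd st))"
proof -
  obtain E M "is" l where st: "st = (E, M, is, l)" by (cases st)
  have "M = matching_edges (arr 0 m)" "r 0 = base 0"
    using assms by (simp_all add: st loop_inv_def graph_inv_def agents_inv_def fixed_regs_def)
  then show ?thesis by (simp add: holds_matching_def st arr_read)
qed

text \<open>The content of \<open>performs_sdmt1\<close> for an arbitrary initial configuration and
  state, so that an execution can be built by adding steps at the front.\<close>

definition execution ::
  "instr list \<Rightarrow> config \<Rightarrow> sdmt_state \<Rightarrow> sdmt_state list \<Rightarrow> nat list \<Rightarrow> nat \<Rightarrow> bool" where
  "execution P c st ss ts T \<longleftrightarrow>
     ss \<noteq> [] \<and> hd ss = st \<and>
     (\<forall>k. Suc k < length ss \<longrightarrow> sdmt1_step I (bfs_selection I) (ss ! k) (ss ! Suc k)) \<and>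
     (\<exists>E M l. last ss = (E, M, [], l)) \<and>
     length ts = length ss \<and> sorted_wrt (<) ts \<and> last ts = T \<and>
     (\<forall>k<length ss. holds_matching I ((ram_step P ^^ (ts ! k)) c) (fst (snd (ss ! k)))) \<and>
     (\<exists>c'. reaches P c T c' \<and> halted P c')"

lemma execution_delay:
  assumes "execution P c' st ss ts T" "reaches P c t c'"
  shows "execution P c st ss (map ((+) t) ts) (t + T)"
proof -
  have eq: "(ram_step P ^^ (t + u)) c = (ram_step P ^^ u) c'" for u
    using assms(2) by (simp add: reaches_def funpow_add add.commute[of t])
  have "ts \<noteq> []" using assms(1) by (auto simp: execution_def)
  moreover have "\<exists>c''. reaches P c (t + T) c'' \<and> halted P c''"
    using assms reaches_trans unfolding execution_def by blast
  ultimately show ?thesis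
    using assms(1) by (auto simp: execution_def eq sorted_wrt_map last_map)
qed

lemma execution_Cons:
  assumes "execution P c st' ss ts T" "\<forall>t\<in>set ts. 0 < t"
    and "sdmt1_step I (bfs_selection I) st st'" "holds_matching I c (fst (snd st))"
  shows "execution P c st (st # ss) (0 # ts) T"
  unfolding execution_def
proof (intro conjI allI impI)
  show "sdmt1_step I (bfs_selection I) ((st # ss) ! k) ((st # ss) ! Suc k)"
    if "Suc k < length (st # ss)" for k
    using that assms(1,3) by (cases k) (auto simp: execution_def hd_conv_nth)
  show "holds_matching I ((ram_step P ^^ ((0 # ts) ! k)) c) (fst (snd ((st # ss) ! k)))"
    if "k < length (st # ss)" for k
    using that assms(1,4) by (cases k) (auto simp: execution_def)
qed (use assms(1,2) in \<open>auto simp: execution_def\<close>)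

lemma main_loop:
  assumes at: "occurs_at P p (compile p (While_less 9 10 step_code))"
    and stop: "length P = p + code_size (While_less 9 10 step_code)"
  shows "loop_inv st r m k \<Longrightarrow> \<exists>T ss ts. T \<le> k \<and> execution P (config_at p r m) st ss ts T"
proof (induction k arbitrary: st r m rule: less_induct)
  case (less k)
  obtain E M "is" l where st: "st = (E, M, is, l)" by (cases st)
  have agents: "agents_inv is r m" and k: "2 \<le> k"
    using less.prems by (simp_all add: st loop_inv_def)
  note R = agents[unfolded agents_inv_def fixed_regs_def]
  show ?case
  proof (cases "is")
    case Nil
    then have "\<not> r 9 < r 10" using R length_order by auto
    then have exit: "reaches P (config_at p r m) 2 (config_at (length P) r m)"
      using reaches_While_exit[OF at] stop by simp
    have "(ram_step P ^^ 2) (config_at p r m) = config_at (length P) r m"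
      using exit by (simp only: reaches_def)
    moreover have "holds_matching I (config_at (length P) r m) M"
      using holds_matching_loop_inv[OF less.prems] st by simp
    moreover have "halted P (config_at (length P) r m)" by (simp add: halted_def)
    \<comment> \<open>The final state is recorded at time 2 and not 0, since the last time must be
      the halting time; leaving the loop takes 2 steps and does not change the memory.\<close>
    ultimately have "execution P (config_at p r m) st [st] [2] 2"
      using exit st Nil unfolding execution_def by auto
    then show ?thesis using k by blast
  next
    case (Cons i is')
    then have "r 9 < r 10" using R agents_inv_Cons(1)[of i is' r m] agents by simp
    moreover have "wp step_code (step_post st) r m (k - 2)"
      using wp_step[of E M i is' l r m k] less.prems st Cons by blast
    ultimately obtain t k' r' m' where 1: "0 < t" "t + k' \<le> k" "step_post st r' m' k'"
      "reaches P (config_at p r m) t (config_at p r' m')"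
      using reaches_While_iteration[OF at _ k] by blast
    then obtain st' where st': "sdmt1_step I (bfs_selection I) st st'" "loop_inv st' r' m' k'"
      by blast
    then obtain T ss ts where 2: "T \<le> k'" "execution P (config_at p r' m') st' ss ts T"
      using less.IH[of k' st' r' m'] 1 by auto
    have "execution P (config_at p r m) st (st # ss) (0 # map ((+) t) ts) (t + T)"
      using execution_delay[OF 2(2) 1(4)] st'(1) holds_matching_loop_inv[OF less.prems] 1(1)
      by (intro execution_Cons) auto
    moreover have "t + T \<le> k" using 1 2 by simp
    ultimately show ?thesis by blast
  qed
qed

lemma performs_sdmt_program: "\<exists>T\<le>total_cost. performs_sdmt1 sdmt_program I \<sigma> w T"
proof -
  let ?P = sdmt_program and ?m = "\<lambda>a. if a < length w then w ! a else 0"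
  let ?p = "code_size init_code"
  have at: "occurs_at ?P 0 (compile 0 init_code)"
    "occurs_at ?P ?p (compile ?p (While_less 9 10 step_code))"
    using occurs_at_self[of ?P] unfolding sdmt_program_def by simp_all
  have size: "length ?P = ?p + code_size (While_less 9 10 step_code)"
    by (simp add: sdmt_program_def)
  obtain t k' r' m' where 1: "t + k' \<le> total_cost" "loop_inv ({}, {}, \<sigma>, 0) r' m' k'"
    "reaches ?P (config_at 0 (\<lambda>_. 0) ?m) t (config_at (0 + ?p) r' m')"
    using wpE[OF wp_init at(1)] .
  have init: "config_at 0 (\<lambda>_. 0) ?m = initial_config w"
    by (simp add: config_at_def initial_config_def)
  obtain T ss ts where 2: "T \<le> k'" "execution ?P (config_at ?p r' m') ({}, {}, \<sigma>, 0) ss ts T"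
    using main_loop[OF at(2) size 1(2)] by blast
  have "execution ?P (initial_config w) ({}, {}, \<sigma>, 0) ss (map ((+) t) ts) (t + T)"
    using execution_delay[OF 2(2)] 1(3) init by simp
  then have "performs_sdmt1 ?P I \<sigma> w (t + T)"
    unfolding performs_sdmt1_def execution_def sdmt1_run_def halts_at_def ram_config_def reaches_def
    by blast
  then show ?thesis using 1(1) 2(1) by (intro exI[of _ "t + T"]) simp
qed

section \<open>Bounding the total cost\<close>

definition list_size :: "nat \<Rightarrow> nat" where
  "list_size i = (\<Sum>xs\<leftarrow>ls ! i. length xs)"

lemma class_nonempty: "i < n \<Longrightarrow> xs \<in> set (ls ! i) \<Longrightarrow> xs \<noteq> []"
  using class_nth(1,2)[of i] by (metis in_set_conv_nth list.set(1))

lemma distinct_concat_classes: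
  assumes "i < n"
  shows "distinct (concat (ls ! i))"
proof (rule distinct_concat)
  have nth: "pref I i ! k = set (ls ! i ! k)" if "k < length (ls ! i)" for k
    using classes[OF assms] that by (metis nth_map)
  have len: "length (pref I i) = length (ls ! i)"
    using classes[OF assms] by (metis length_map)
  have disjoint: "set (ls ! i ! k) \<inter> set (ls ! i ! l) = {}"
    if "k < length (ls ! i)" "l < length (ls ! i)" "k \<noteq> l" for k l
    using ha assms that nth len unfolding ha_instance_def by metis
  then show "set ys \<inter> set zs = {}" if "ys \<in> set (ls ! i)" "zs \<in> set (ls ! i)" "ys \<noteq> zs" for ys zs
    using that by (metis in_set_conv_nth)
  show "distinct (ls ! i)"
    unfolding distinct_conv_nth
  proof (intro allI impI)
    \<comment> \<open>Equal classes at different positions would be disjoint from themselves, hence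
      empty.\<close>
    fix k l assume kl: "k < length (ls ! i)" "l < length (ls ! i)" "k \<noteq> l"
    then have "ls ! i ! k \<noteq> []" using class_nonempty assms by simp
    then show "ls ! i ! k \<noteq> ls ! i ! l" using disjoint[OF kl] by auto
  qed
qed (use distinct_classes assms in blast)

lemma total_pref_length_eq: "total_pref_length I = (\<Sum>i<n. list_size i)"
proof -
  have size: "finite (\<Union> (set (pref I i))) \<and> card (\<Union> (set (pref I i))) = list_size i" if "i < n" for i
  proof -
    have "\<Union> (set (pref I i)) = set (concat (ls ! i))"
      using classes[OF that] by (metis set_concat set_map)
    then show ?thesis
      using distinct_card[OF distinct_concat_classes[OF that]]
      by (simp add: list_size_def length_concat)
  qed
  have "{(i, ob). i < n \<and> ob \<in> \<Union> (set (pref I i))} = (SIGMA i:{..<n}. \<Union> (set (pref I i)))"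
    by auto
  then show ?thesis
    unfolding total_pref_length_def using size by (simp add: card_SigmaI)
qed

text \<open>A nonempty class has at least one object to carry its fixed charge; thus the number of
  classes is absorbed into the total length of the lists.\<close>

lemma sum_nonempty_le:
  assumes "\<forall>xs\<in>set cs. xs \<noteq> []"
  shows "(\<Sum>xs\<leftarrow>cs. a + b * length xs) \<le> (a + b) * (\<Sum>xs\<leftarrow>cs. length xs)"
  using assms
proof (induction cs)
  case (Cons xs cs)
  then have "a \<le> a * length xs" by (cases xs) auto
  then have "a + b * length xs \<le> (a + b) * length xs" by (simp add: add_mult_distrib)
  then show ?case using Cons by (simp add: distrib_left add_mono)
qed simp

lemma class_cost_le: "i < n \<Longrightarrow> class_cost (ls ! i) \<le> 75 * list_size i"
  using sum_nonempty_le[of "ls ! i" 50 25] class_nonempty by (simp add: class_cost_def list_size_def)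

lemma number_of_classes_le: "i < n \<Longrightarrow> length (ls ! i) \<le> list_size i"
  using sum_nonempty_le[of "ls ! i" 1 0] class_nonempty
  by (simp add: list_size_def sum_list_triv)

text \<open>Positivity of \<open>\<gamma>\<close> is what lets \<open>n * n * \<gamma>\<close>
  dominate the terms from initialization, augmentation and dequeuing, in which
  \<open>\<gamma>\<close> does not occur.\<close>

lemma total_cost_le:
  assumes "0 < \<gamma>"
  shows "total_cost \<le> 200 * (n\<^sup>2 * \<gamma> + total_pref_length I)"
proof -
  have "{card C | C i. i < n \<and> C \<in> set (pref I i)} \<noteq> {}"
  proof
    assume "{card C | C i. i < n \<and> C \<in> set (pref I i)} = {}"
    then have "\<gamma> = Max (insert 0 {})" unfolding max_class_size_def by (simp only:)
    then show False using assms by simp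
  qed
  then have "0 < n" by auto
  have "scan_cost 0 = (\<Sum>i<n. 9 + 6 * length (ls ! i))"
    by (simp add: scan_cost_def sum_list_sum_nth length_ls atLeast0LessThan)
  also have "\<dots> \<le> (\<Sum>i<n. 9 + 6 * list_size i)"
    using number_of_classes_le by (intro sum_mono) simp
  also have "\<dots> = 9 * n + 6 * total_pref_length I"
    by (simp add: total_pref_length_eq sum.distrib sum_distrib_left)
  finally have scan: "scan_cost 0 \<le> 9 * n + 6 * total_pref_length I" .
  have "(\<Sum>i\<leftarrow>\<sigma>. agent_cost i) = (\<Sum>i<n. agent_cost i)"
    using order by (simp add: agent_order_def sum_list_distinct_conv_sum_set)
  also have "\<dots> \<le> (\<Sum>i<n. 75 * list_size i + (25 * (n * (1 + \<gamma>)) + 14 * n + 50))"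
    using class_cost_le by (intro sum_mono) (simp add: agent_cost_def)
  also have "\<dots> = 75 * total_pref_length I + n * (25 * (n * (1 + \<gamma>)) + 14 * n + 50)"
    by (simp add: total_pref_length_eq sum.distrib sum_distrib_left)
  finally have "total_cost \<le> 40 + 18 * n + 87 * total_pref_length I +
      n * (25 * (n * (1 + \<gamma>)) + 14 * n + 50)"
    using scan by (simp add: total_cost_def)
  also have "\<dots> = 40 + 68 * n + 39 * (n * n) + 25 * (n * n * \<gamma>) + 87 * total_pref_length I"
    by (simp add: algebra_simps)
  also have "\<dots> \<le> 200 * (n\<^sup>2 * \<gamma> + total_pref_length I)"
  proof -
    have "n * n \<le> n * n * \<gamma>" "n \<le> n * n" using assms \<open>0 < n\<close> by simp_all
    then have "1 \<le> n * n * \<gamma>" "n \<le> n * n * \<gamma>" "n * n \<le> n * n * \<gamma>" using \<open>0 < n\<close> by linarith+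
    \<comment> \<open>Each of 1, \<open>n\<close> and \<open>n * n\<close> is replaced by
      \<open>n * n * \<gamma>\<close>; the coefficients then add up to 172.\<close>
    then have "40 + 68 * n + 39 * (n * n) + 25 * (n * n * \<gamma>) + 87 * total_pref_length I \<le>
        40 * (n * n * \<gamma>) + 68 * (n * n * \<gamma>) + 39 * (n * n * \<gamma>) + 25 * (n * n * \<gamma>) +
        200 * total_pref_length I"
      by (intro add_mono mult_le_mono2) simp_all
    then show ?thesis unfolding power2_eq_square by simp
  qed
  finally show ?thesis .
qed

end

theorem theorem3p5:
  shows "\<exists>(P :: instr list) (c :: nat). \<forall>(I :: instance_ha) (\<sigma> :: nat list) (w :: nat list).
           ha_instance I \<and> agent_order I \<sigma> \<and> input_word I \<sigma> w \<longrightarrow>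
           (\<exists>T. performs_sdmt1 P I \<sigma> w T \<and>
                (0 < max_class_size I \<longrightarrow>
                 T \<le> c * ((num_agents I)\<^sup>2 * max_class_size I + total_pref_length I)))"
proof -
  have "\<exists>T. performs_sdmt1 sdmt_program I \<sigma> w T \<and>
      (0 < max_class_size I \<longrightarrow>
       T \<le> 200 * ((num_agents I)\<^sup>2 * max_class_size I + total_pref_length I))"
    if asm: "ha_instance I \<and> agent_order I \<sigma> \<and> input_word I \<sigma> w" for I \<sigma> w
  proof -
    from asm obtain ls where "length ls = num_agents I"
      "\<forall>i<num_agents I. map set (ls ! i) = pref I i \<and> (\<forall>xs\<in>set (ls ! i). distinct xs)"
      "w = [num_agents I, num_objects I] @ \<sigma> @ concat (map agent_word ls)"
      unfolding input_word_def by blast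
    with asm interpret sdmt_input I \<sigma> ls w by unfold_locales auto
    obtain T where "T \<le> total_cost" "performs_sdmt1 sdmt_program I \<sigma> w T"
      using performs_sdmt_program by blast
    then show ?thesis using total_cost_le order_trans by (intro exI[of _ T]) auto
  qed
  then show ?thesis by blast
qed

end
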